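(* Let $\theta$ be a primitive, length $r$ substitution such that $(X_\theta,\sigma)$ is infinite. (1) Let $\theta$ have height one. If $\kappa:\mathrm{Aut}(X_\theta,\sigma)\to\mathbb Z_r$ is injective (in particular if $\theta$ has a coincidence), then $\mathrm{Aut}(X_\theta,\sigma)$ is cyclic. (2) Let $\theta$ have height $h>1$ and let $\theta'$ be the pure base of $\theta$. Suppose that $\kappa:\mathrm{Aut}(X_{\theta'},\sigma')\to\mathbb Z_r$ is injective, so that $\mathrm{Aut}(X_{\theta'},\sigma')=\langle\Phi\rangle$ with $\kappa(\Phi)=1/k$ for some positive integer $k$. Then $\mathrm{Aut}(X_\theta,\sigma)$ is abelian and generated by $T$ and $\Phi_0$. Further, $\mathrm{Aut}(X_\theta,\sigma)$ is cyclic if and only if $\gcd(k,h)=1$.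
   Context: $\mathcal A$ is a finite alphabet. A substitution of length $r$ is a map $\theta:\mathcal A\to\mathcal A^r$, extended by concatenation to finite and infinite words; write $\theta(a)=\theta_0(a)\cdots\theta_{r-1}(a)$, so each $\theta_i:\mathcal A\to\mathcal A$. $\theta$ is primitive if for some $k$, every letter occurs in $\theta^k(a)$ for every letter $a$. $X_\theta\subset\mathcal A^{\mathbb Z}$ is the two-sided shift of all bi-infinite sequences all of whose finite subwords occur in a one-sided $\theta$-periodic point, with shift map $\sigma$. $\mathrm{Aut}$ of a system is the group of its self-homeomorphisms commuting with the dynamics. Height: with $u=u_0u_1\ldots$ a fixed point of $\theta$ (or of a power of $\theta$), $h(\theta)=\max\{n\ge1:\gcd(n,r)=1,\ n\mid\gcd\{a:u_a=u_0\}\}$. A pure base of $\theta$, where $\theta$ has height $h$, is a primitive length $r$ substitution $\theta'$ of height one (with shift map $\sigma'$ on $X_{\theta'}$) such that $(X_\theta,\sigma)$ is topologically conjugate to $(X_{\theta'}\times\{0,\ldots,h-1\},T)$, where $T(x,i)=(x,i+1)$ if $0\le i<h-1$ and $T(x,h-1)=(\sigma'(x),0)$; such $\theta'$ always exists. In (2), $\mathrm{Aut}(X_\theta,\sigma)$ is identified with $\mathrm{Aut}(X_{\theta'}\times\{0,\ldots,h-1\},T)$ through this conjugacy, and $\Phi_0(x,j)=(\Phi(x),j)$. A substitution $\theta$ of height one has a coincidence if $|\theta_{i_1}\circ\cdots\circ\theta_{i_k}(\mathcal A)|=1$ for some $k\ge 1$ and some $i_1,\ldots,i_k\in\{0,\ldots,r-1\}$.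 $\mathbb Z_r$ is the additive group of $r$-adic integers ($r$ not necessarily prime); for $k$ coprime to $r$, $1/k\in\mathbb Z_r$ makes sense. For a primitive length $r$ substitution $\theta$ of height one with $X_\theta$ infinite, the maximal equicontinuous factor of $(X_\theta,\sigma)$ is $(\mathbb Z_r,+1)$; let $\pi$ be the factor map. For $\Phi\in\mathrm{Aut}(X_\theta,\sigma)$, $\kappa(\Phi)\in\mathbb Z_r$ is the unique element with $\pi(\Phi(x))=\kappa(\Phi)+\pi(x)$ for all $x$; $\kappa$ is a group homomorphism. *)

theory Defs
  imports
    "HOL-Analysis.Analysis"
    "HOL-Algebra.Bij"
    "HOL-Algebra.Elementary_Groups"
    "HOL-Algebra.Ring"
begin

section \<open>Substitutions of constant length\<close>

text \<open>The alphabet is a finite type; \<open>\<theta>\<^sub>i a\<close> is \<open>\<theta> a ! i\<close>.\<close>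

definition substitution :: "nat \<Rightarrow> ('a::finite \<Rightarrow> 'a list) \<Rightarrow> bool" where
  "substitution r \<theta> \<longleftrightarrow> (\<forall>a. length (\<theta> a) = r)"

definition subst_word :: "('a \<Rightarrow> 'a list) \<Rightarrow> 'a list \<Rightarrow> 'a list" where
  "subst_word \<theta> w = concat (map \<theta> w)"

text \<open>The concatenation \<open>\<theta>(u\<^sub>0)\<theta>(u\<^sub>1)\<dots>\<close>: since all blocks have length \<open>r\<close>, its
  \<open>n\<close>-th letter is letter number \<open>n mod r\<close> of block number \<open>n div r\<close>.\<close>

definition subst_seq :: "nat \<Rightarrow> ('a \<Rightarrow> 'a list) \<Rightarrow> (nat \<Rightarrow> 'a) \<Rightarrow> (nat \<Rightarrow> 'a)" where
  "subst_seq r \<theta> u = (\<lambda>n. \<theta> (u (n div r)) ! (n mod r))"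

definition primitive :: "('a::finite \<Rightarrow> 'a list) \<Rightarrow> bool" where
  "primitive \<theta> \<longleftrightarrow> (\<exists>k. \<forall>a b. b \<in> set ((subst_word \<theta> ^^ k) [a]))"

definition periodic_point :: "nat \<Rightarrow> ('a \<Rightarrow> 'a list) \<Rightarrow> (nat \<Rightarrow> 'a) \<Rightarrow> bool" where
  "periodic_point r \<theta> u \<longleftrightarrow> (\<exists>p\<ge>1. (subst_seq r \<theta> ^^ p) u = u)"

definition height_at :: "nat \<Rightarrow> (nat \<Rightarrow> 'a) \<Rightarrow> nat" where
  "height_at r u = Max {n. 1 \<le> n \<and> gcd n r = 1 \<and> n dvd Gcd {a. u a = u 0}}"

text \<open>For primitive \<open>\<theta>\<close> with infinite shift space the value does not depend on the
  periodic point that is chosen.\<close>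

definition height :: "nat \<Rightarrow> ('a \<Rightarrow> 'a list) \<Rightarrow> nat" where
  "height r \<theta> = height_at r (SOME u. periodic_point r \<theta> u)"

definition has_coincidence :: "nat \<Rightarrow> ('a::finite \<Rightarrow> 'a list) \<Rightarrow> bool" where
  "has_coincidence r \<theta> \<longleftrightarrow>
    (\<exists>is. is \<noteq> [] \<and> set is \<subseteq> {..<r} \<and>
      card (foldr (\<lambda>i f. (\<lambda>a. \<theta> a ! i) \<circ> f) is id ` UNIV) = 1)"

section \<open>The two-sided shift\<close>

definition X_shift :: "nat \<Rightarrow> ('a \<Rightarrow> 'a list) \<Rightarrow> (int \<Rightarrow> 'a) set" where
  "X_shift r \<theta> = {x. \<exists>u. periodic_point r \<theta> u \<and>
     (\<forall>i n. \<exists>j. \<forall>m<n. x (i + int m) = u (j + m))}"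

definition X_top :: "nat \<Rightarrow> ('a \<Rightarrow> 'a list) \<Rightarrow> (int \<Rightarrow> 'a) topology" where
  "X_top r \<theta> = subtopology (product_topology (\<lambda>_. discrete_topology UNIV) UNIV) (X_shift r \<theta>)"

definition shift :: "(int \<Rightarrow> 'a) \<Rightarrow> (int \<Rightarrow> 'a)" where
  "shift x = (\<lambda>n. x (n + 1))"

section \<open>Dynamical systems\<close>

text \<open>A system is a topology together with a self-map; only the values of the map on the
  underlying space matter.\<close>

definition factor_map ::
    "'x topology \<Rightarrow> ('x \<Rightarrow> 'x) \<Rightarrow> 'y topology \<Rightarrow> ('y \<Rightarrow> 'y) \<Rightarrow> ('x \<Rightarrow> 'y) \<Rightarrow> bool" where
  "factor_map X S Y T p \<longleftrightarrow> continuous_map X Y p \<and> p ` topspace X = topspace Y \<and>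
     (\<forall>x\<in>topspace X. p (S x) = T (p x))"

definition conjugacy ::
    "'x topology \<Rightarrow> ('x \<Rightarrow> 'x) \<Rightarrow> 'y topology \<Rightarrow> ('y \<Rightarrow> 'y) \<Rightarrow> ('x \<Rightarrow> 'y) \<Rightarrow> bool" where
  "conjugacy X S Y T F \<longleftrightarrow> homeomorphic_map X Y F \<and> (\<forall>x\<in>topspace X. F (S x) = T (F x))"

definition Aut :: "'x topology \<Rightarrow> ('x \<Rightarrow> 'x) \<Rightarrow> ('x \<Rightarrow> 'x) monoid" where
  "Aut X S = BijGroup (topspace X)
     \<lparr>carrier := {f \<in> Bij (topspace X). homeomorphic_map X X f \<and>
        (\<forall>x\<in>topspace X. f (S x) = S (f x))}\<rparr>"

text \<open>Transport of a self-map \<open>f\<close> of the target of \<open>F\<close> to \<open>F\<^sup>-\<^sup>1 \<circ> f \<circ> F\<close>, made extensional on \<open>X\<close>.\<close>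

definition pull_back :: "'x topology \<Rightarrow> ('x \<Rightarrow> 'y) \<Rightarrow> ('y \<Rightarrow> 'y) \<Rightarrow> ('x \<Rightarrow> 'x)" where
  "pull_back X F f = restrict (\<lambda>x. inv_into (topspace X) F (f (F x))) (topspace X)"

text \<open>Equicontinuity of all integer powers of a self-homeomorphism of a compact metrizable space.\<close>

definition equicontinuous_system :: "'y topology \<Rightarrow> ('y \<Rightarrow> 'y) \<Rightarrow> bool" where
  "equicontinuous_system Y T \<longleftrightarrow> compact_space Y \<and> homeomorphic_map Y Y T \<and>
     (\<exists>d. Metric_space (topspace Y) d \<and> Metric_space.mtopology (topspace Y) d = Y \<and>
       (\<forall>\<epsilon>>0. \<exists>\<delta>>0. \<forall>x\<in>topspace Y. \<forall>y\<in>topspace Y. d x y < \<delta> \<longrightarrow>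
         (\<forall>n. d ((T ^^ n) x) ((T ^^ n) y) < \<epsilon> \<and>
              d ((inv_into (topspace Y) T ^^ n) x) ((inv_into (topspace Y) T ^^ n) y) < \<epsilon>)))"

text \<open>The competing factors \<open>Y\<close> range over topologies on the type of sets of points of \<open>X\<close>. This is
  no restriction: every factor of \<open>X\<close> can be carried over to the set of fibres of its factor map.\<close>

definition max_equicontinuous_factor ::
    "'x topology \<Rightarrow> ('x \<Rightarrow> 'x) \<Rightarrow> 'z topology \<Rightarrow> ('z \<Rightarrow> 'z) \<Rightarrow> ('x \<Rightarrow> 'z) \<Rightarrow> bool" where
  "max_equicontinuous_factor X S Z R \<pi> \<longleftrightarrow>
     equicontinuous_system Z R \<and> factor_map X S Z R \<pi> \<and>
     (\<forall>(Y :: 'x set topology) T p. equicontinuous_system Y T \<and> factor_map X S Y T p \<longrightarrow>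
        (\<exists>q. factor_map Z R Y T q \<and> (\<forall>x\<in>topspace X. p x = q (\<pi> x))))"

section \<open>The \<open>r\<close>-adic integers\<close>

text \<open>\<open>\<int>\<^sub>r\<close> as the inverse limit of the rings \<open>\<int>/r\<^sup>n\<close>; the \<open>n\<close>-th entry is the residue modulo \<open>r\<^sup>n\<close>.\<close>

definition radic :: "nat \<Rightarrow> (nat \<Rightarrow> int) ring" where
  "radic r =
    \<lparr>carrier = {z. \<forall>n. 0 \<le> z n \<and> z n < int r ^ n \<and> z (Suc n) mod int r ^ n = z n},
     mult = \<lambda>x y n. (x n * y n) mod int r ^ n,
     one = \<lambda>n. 1 mod int r ^ n,
     zero = \<lambda>n. 0,
     add = \<lambda>x y n. (x n + y n) mod int r ^ n\<rparr>"

definition radic_top :: "nat \<Rightarrow> (nat \<Rightarrow> int) topology" where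
  "radic_top r = subtopology (product_topology (\<lambda>_. discrete_topology UNIV) UNIV) (carrier (radic r))"

definition radic_succ :: "nat \<Rightarrow> (nat \<Rightarrow> int) \<Rightarrow> (nat \<Rightarrow> int)" where
  "radic_succ r z = z \<oplus>\<^bsub>radic r\<^esub> \<one>\<^bsub>radic r\<^esub>"

text \<open>The element \<open>1/k\<close> of \<open>\<int>\<^sub>r\<close>; meaningful only for \<open>k\<close> coprime to \<open>r\<close>.\<close>

definition radic_recip :: "nat \<Rightarrow> nat \<Rightarrow> (nat \<Rightarrow> int)" where
  "radic_recip r k = inv\<^bsub>radic r\<^esub> ([k] \<cdot>\<^bsub>radic r\<^esub> \<one>\<^bsub>radic r\<^esub>)"

text \<open>Two maximal equicontinuous factor maps onto \<open>(\<int>\<^sub>r, +1)\<close> differ by a translation, so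
  \<open>\<kappa>\<close> does not depend on \<open>\<pi>\<close>.\<close>

definition radic_mef :: "nat \<Rightarrow> ('a \<Rightarrow> 'a list) \<Rightarrow> ((int \<Rightarrow> 'a) \<Rightarrow> (nat \<Rightarrow> int)) \<Rightarrow> bool" where
  "radic_mef r \<theta> \<pi> \<longleftrightarrow>
     max_equicontinuous_factor (X_top r \<theta>) shift (radic_top r) (radic_succ r) \<pi>"

definition kappa :: "nat \<Rightarrow> ('a \<Rightarrow> 'a list) \<Rightarrow> ((int \<Rightarrow> 'a) \<Rightarrow> (nat \<Rightarrow> int)) \<Rightarrow>
    ((int \<Rightarrow> 'a) \<Rightarrow> (int \<Rightarrow> 'a)) \<Rightarrow> (nat \<Rightarrow> int)" where
  "kappa r \<theta> \<pi> \<Phi> = (THE z. z \<in> carrier (radic r) \<and>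
     (\<forall>x\<in>X_shift r \<theta>. \<pi> (\<Phi> x) = z \<oplus>\<^bsub>radic r\<^esub> \<pi> x))"

definition reciprocal_generator :: "nat \<Rightarrow> ('a \<Rightarrow> 'a list) \<Rightarrow> ((int \<Rightarrow> 'a) \<Rightarrow> (nat \<Rightarrow> int)) \<Rightarrow>
    ((int \<Rightarrow> 'a) \<Rightarrow> (int \<Rightarrow> 'a)) \<Rightarrow> nat \<Rightarrow> bool" where
  "reciprocal_generator r \<theta> \<pi> \<Phi> k \<longleftrightarrow>
     \<Phi> \<in> carrier (Aut (X_top r \<theta>) shift) \<and>
     carrier (Aut (X_top r \<theta>) shift) = generate (Aut (X_top r \<theta>) shift) {\<Phi>} \<and>
     k > 0 \<and> coprime k r \<and> kappa r \<theta> \<pi> \<Phi> = radic_recip r k"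

section \<open>Pure base\<close>

definition tower_top :: "nat \<Rightarrow> ('a \<Rightarrow> 'a list) \<Rightarrow> nat \<Rightarrow> ((int \<Rightarrow> 'a) \<times> nat) topology" where
  "tower_top r \<theta> h = prod_topology (X_top r \<theta>) (discrete_topology {0..<h})"

definition tower_map :: "nat \<Rightarrow> (int \<Rightarrow> 'a) \<times> nat \<Rightarrow> (int \<Rightarrow> 'a) \<times> nat" where
  "tower_map h = (\<lambda>(x, i). if i + 1 < h then (x, i + 1) else (shift x, 0))"

definition level_map ::
    "((int \<Rightarrow> 'a) \<Rightarrow> (int \<Rightarrow> 'a)) \<Rightarrow> (int \<Rightarrow> 'a) \<times> nat \<Rightarrow> (int \<Rightarrow> 'a) \<times> nat" where
  "level_map \<Phi> = (\<lambda>(x, j). (\<Phi> x, j))"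

definition tower_conjugacy ::
    "nat \<Rightarrow> ('a \<Rightarrow> 'a list) \<Rightarrow> ('b \<Rightarrow> 'b list) \<Rightarrow> ((int \<Rightarrow> 'a) \<Rightarrow> (int \<Rightarrow> 'b) \<times> nat) \<Rightarrow> bool" where
  "tower_conjugacy r \<theta> \<theta>' F \<longleftrightarrow>
     conjugacy (X_top r \<theta>) shift (tower_top r \<theta>' (height r \<theta>)) (tower_map (height r \<theta>)) F"

definition pure_base :: "nat \<Rightarrow> ('a \<Rightarrow> 'a list) \<Rightarrow> ('b::finite \<Rightarrow> 'b list) \<Rightarrow> bool" where
  "pure_base r \<theta> \<theta>' \<longleftrightarrow> substitution r \<theta>' \<and> primitive \<theta>' \<and> height r \<theta>' = 1 \<and>
     (\<exists>F. tower_conjugacy r \<theta> \<theta>' F)"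

end

theory Submission
  imports Defs
begin

text \<open>\<open>X\<close> is minimal, so \<open>\<pi>\<close> modulo \<open>r\<^sup>n\<close> is constant on \<open>\<theta>\<^sup>n(X)\<close>; hence points with
  the same image under \<open>\<pi>\<close> are cut into blocks \<open>\<theta>\<^sup>n(a)\<close> at the same places, for every \<open>n\<close>. Therefore
  right-asymptotic pairs, up to the shift, are determined by boundedly many letters of their
  desubstitutions and are finite in number. There is at least one, because \<open>X\<close> is infinite.
  Automorphisms permute these pairs and are determined by their value at one point, so \<open>\<sigma>\<close>
  generates a subgroup of finite index. If \<open>\<kappa>\<close> is injective, the automorphism group is moreover abelian and
  torsion-free, hence infinite cyclic, with \<open>\<Phi>\<^sup>k = \<sigma>\<close> for a generator \<open>\<Phi>\<close>.

  Over a tower of height \<open>h\<close>, minimality of the base makes every automorphism carry levels to levels.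
  After composing with a power of \<open>T\<close> it comes from an automorphism of the base, so the group is
  generated by \<open>T\<close> and \<open>\<Phi>\<^sub>0\<close> with the single relation \<open>T\<^sup>h = \<Phi>\<^sub>0\<^sup>k\<close> between commuting generators. It is
  \<open>\<int> \<times> \<int>/gcd(k,h)\<close>.\<close>

section \<open>Minimality of the shift space\<close>

text \<open>Abelian and torsion-free is far from cyclic: \<int>_r contains \<int>[1/p] for every
  prime p not dividing r, and there 1, the value of \<kappa> at the shift, is divisible by every
  p^j. What must be bounded are the denominators. Distinct cosets of the group generated by \<sigma>
  receive distinct labels among the finitely many first components of asymptotic pairs, and this
  bounds the index. One principle produces all the constants: a locally constant function on X that
  is invariant under the shift is constant, because forward orbits are dense
  (\<open>invariant_constant\<close>). It is applied to \<pi> modulo r^n on the points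
  \<theta>^n(y), to the displacement of \<pi> under an automorphism, which makes \<kappa> well
  defined, and to the floor on which an automorphism of the tower puts the bottom floor. Topology is
  translated into agreement on windows [-N, N], so that compactness becomes a pigeonhole argument on
  finite words.\<close>

primrec column :: "nat \<Rightarrow> ('a \<Rightarrow> 'a list) \<Rightarrow> nat \<Rightarrow> nat \<Rightarrow> 'a \<Rightarrow> 'a" where
  "column r \<theta> 0 i a = a"
| "column r \<theta> (Suc n) i a = \<theta> (column r \<theta> n (i div r) a) ! (i mod r)"

text \<open>\<theta>^(m+n)(a) is the concatenation of the blocks \<theta>^m(c) over the letters c of
  \<theta>^n(a), and position i falls into block number \<open>i div r ^ m\<close>.\<close>

lemma column_add:
  "column r \<theta> (m + n) i a = column r \<theta> m i (column r \<theta> n (i div r ^ m) a)"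
  by (induction m arbitrary: i) (auto simp: div_mult2_eq)

text \<open>Only the lowest n base-r digits of the position are read, so \<open>column\<close> is
  total: past the end of \<theta>^n(a) it starts again.\<close>

lemma column_periodic:
  "r > 0 \<Longrightarrow> column r \<theta> n (i * r ^ n + t) a = column r \<theta> n t a"
proof (induction n arbitrary: t)
  case (Suc n)
  have "i * r ^ Suc n + t = t + (i * r ^ n) * r" by simp
  then have "(i * r ^ Suc n + t) div r = i * r ^ n + t div r"
    "(i * r ^ Suc n + t) mod r = t mod r"
    using Suc.prems by (metis div_mult_self1 add.commute not_gr_zero) (metis \<open>i * r ^ Suc n + t = t + (i * r ^ n) * r\<close> mod_mult_self1)
  then show ?case using Suc by simp
qed simp

lemma subst_seq_power:
  "(subst_seq r \<theta> ^^ n) u = (\<lambda>i. column r \<theta> n i (u (i div r ^ n)))"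
  by (induction n) (auto simp: subst_seq_def div_mult2_eq)

lemma subst_word_power_column:
  assumes "substitution r \<theta>" and "b \<in> set ((subst_word \<theta> ^^ n) [a])"
  shows "\<exists>i<r ^ n. column r \<theta> n i a = b"
  using assms(2)
proof (induction n arbitrary: b)
  case (Suc n)
  then obtain c where c: "c \<in> set ((subst_word \<theta> ^^ n) [a])" "b \<in> set (\<theta> c)"
    using subst_word_def[of \<theta> "(subst_word \<theta> ^^ n) [a]"] by auto
  then obtain i j where i: "i < r ^ n" "column r \<theta> n i a = c" and j: "j < r" "\<theta> c ! j = b"
    using Suc.IH assms(1) by (metis in_set_conv_nth substitution_def)
  have "i * r + j < Suc i * r" using j by simp
  also have "\<dots> \<le> r ^ n * r" using i by (intro mult_right_mono) auto
  finally have "i * r + j < r ^ Suc n" by (simp add: mult.commute)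
  then show ?case using i j by (intro exI[of _ "i * r + j"]) auto
qed simp

section \<open>Windows of two-sided sequences and compactness\<close>

definition agree :: "nat \<Rightarrow> (int \<Rightarrow> 'a) \<Rightarrow> (int \<Rightarrow> 'a) \<Rightarrow> bool" where
  "agree N x y \<longleftrightarrow> (\<forall>i. \<bar>i\<bar> \<le> int N \<longrightarrow> x i = y i)"

lemma agree_sym: "agree N x y \<Longrightarrow> agree N y x"
  by (auto simp: agree_def)

lemma agree_mono: "agree N x y \<Longrightarrow> M \<le> N \<Longrightarrow> agree M x y"
  by (force simp: agree_def)

lemma agree_trans: "agree N x y \<Longrightarrow> agree N y z \<Longrightarrow> agree N x z"
  by (auto simp: agree_def)

lemma agree_all_eq: "(\<And>N. agree N x y) \<Longrightarrow> x = y"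
proof
  fix i assume "\<And>N. agree N x y"
  then have "agree (nat \<bar>i\<bar>) x y" .
  then show "x i = y i" by (auto simp: agree_def)
qed

text \<open>Compactness by nested pigeonholes: on each window some word is shared by infinitely many
  members, and each such word is chosen to extend the previous one. The letter type is left general
  because the lemma is also applied to sequences of pairs of letters.\<close>

lemma exists_limit_point:
  fixes f :: "nat \<Rightarrow> int \<Rightarrow> 'c::finite"
  assumes "infinite I"
  shows "\<exists>g. \<forall>N. infinite {n\<in>I. agree N (f n) g}"
proof -
  have step: "\<exists>w'. infinite {n\<in>I. agree (Suc N) (f n) w'} \<and> agree N w w'"
    if inf: "infinite {n\<in>I. agree N (f n) w}" for w N
  proof -
    let ?A = "{n\<in>I. agree N (f n) w}"
    let ?J = "{- int (Suc N)..int (Suc N)}"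
    have "(\<lambda>n. restrict (f n) ?J) ` ?A \<subseteq> PiE ?J (\<lambda>_. UNIV)" by auto
    then have "finite ((\<lambda>n. restrict (f n) ?J) ` ?A)"
      by (rule finite_subset) (intro finite_PiE; simp)
    from pigeonhole_infinite[OF inf this] obtain n0 where n0: "n0 \<in> ?A"
      and inf': "infinite {n \<in> ?A. restrict (f n) ?J = restrict (f n0) ?J}" by auto
    have "{n \<in> ?A. restrict (f n) ?J = restrict (f n0) ?J} \<subseteq> {n\<in>I. agree (Suc N) (f n) (f n0)}"
    proof safe
      fix n assume eq: "restrict (f n) ?J = restrict (f n0) ?J"
      show "agree (Suc N) (f n) (f n0)" unfolding agree_def
      proof (intro allI impI)
        fix i assume "\<bar>i\<bar> \<le> int (Suc N)"
        then have "i \<in> ?J" by auto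
        then show "f n i = f n0 i" using fun_cong[OF eq, of i] by simp
      qed
    qed
    then have "infinite {n\<in>I. agree (Suc N) (f n) (f n0)}"
      using inf' finite_subset by blast
    moreover have "agree N w (f n0)" using n0 by (simp add: agree_sym)
    ultimately show ?thesis by blast
  qed
  have base: "\<exists>w. infinite {n\<in>I. agree 0 (f n) w}"
  proof -
    from pigeonhole_infinite[OF assms, of "\<lambda>n. f n 0"] obtain n0 where
      "infinite {n \<in> I. f n 0 = f n0 0}" by auto
    then show ?thesis by (intro exI[of _ "f n0"]) (simp add: agree_def)
  qed
  obtain W where W: "\<And>N. infinite {n\<in>I. agree N (f n) (W N)}" "\<And>N. agree N (W N) (W (Suc N))"
    using dependent_nat_choice[of "\<lambda>N w. infinite {n\<in>I. agree N (f n) w}" "\<lambda>N w w'. agree N w w'"]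
      base step by blast
  have WW: "agree N (W N) (W (N + d))" for N d
  proof (induction d)
    case (Suc d)
    then show ?case using agree_mono[OF W(2)[of "N + d"], of N] agree_trans by auto
  qed (simp add: agree_def)
  \<comment> \<open>Coordinate i no longer changes from the window of radius |i| on, so the diagonal
    reads it there.\<close>
  define g where "g = (\<lambda>i::int. W (nat \<bar>i\<bar>) i)"
  have "agree N (W N) g" for N
    unfolding agree_def g_def
  proof (intro allI impI)
    fix i :: int assume "\<bar>i\<bar> \<le> int N"
    then have "agree (nat \<bar>i\<bar>) (W (nat \<bar>i\<bar>)) (W N)" using WW[of "nat \<bar>i\<bar>" "N - nat \<bar>i\<bar>"] by simp
    then show "W N i = W (nat \<bar>i\<bar>) i" by (auto simp: agree_def)
  qed
  then have "{n\<in>I. agree N (f n) (W N)} \<subseteq> {n\<in>I. agree N (f n) g}" for N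
    using agree_trans by blast
  then show ?thesis using W(1) finite_subset by blast
qed

text \<open>The code set C does not grow with N. Among card C + 1 distinct points a single window
  would separate all pairs, and the code for that window would be injective on them.\<close>

lemma finite_if_finitely_coded:
  fixes Z :: "(int \<Rightarrow> 'a) set"
  assumes "finite C"
    and "\<And>N. \<exists>g. g ` Z \<subseteq> C \<and> (\<forall>x\<in>Z. \<forall>y\<in>Z. g x = g y \<longrightarrow> agree N x y)"
  shows "finite Z"
proof (rule ccontr)
  assume "infinite Z"
  then obtain F where F: "finite F" "card F = Suc (card C)" "F \<subseteq> Z"
    using infinite_arbitrarily_large by blast
  have "\<exists>N. \<forall>x\<in>F. \<forall>y\<in>F. agree N x y \<longrightarrow> x = y"
  proof -
    have "\<exists>N. agree N (fst p) (snd p) \<longrightarrow> fst p = snd p" for p :: "(int \<Rightarrow> 'a) \<times> (int \<Rightarrow> 'a)"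
      using agree_all_eq by blast
    then obtain M where M: "\<And>p :: (int \<Rightarrow> 'a) \<times> (int \<Rightarrow> 'a). agree (M p) (fst p) (snd p) \<longrightarrow> fst p = snd p"
      by metis
    have "\<forall>x\<in>F. \<forall>y\<in>F. agree (Max (M ` (F \<times> F))) x y \<longrightarrow> x = y"
    proof (intro ballI impI)
      fix x y assume "x \<in> F" "y \<in> F" and ag: "agree (Max (M ` (F \<times> F))) x y"
      then have "M (x, y) \<le> Max (M ` (F \<times> F))" using F(1) by (intro Max_ge) auto
      then show "x = y" using M[of "(x, y)"] agree_mono[OF ag] by simp
    qed
    then show ?thesis by blast
  qed
  then obtain N where N: "\<And>x y. x\<in>F \<Longrightarrow> y\<in>F \<Longrightarrow> agree N x y \<Longrightarrow> x = y" by blast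
  obtain g where g: "g ` Z \<subseteq> C" "\<forall>x\<in>Z. \<forall>y\<in>Z. g x = g y \<longrightarrow> agree N x y"
    using assms(2) by blast
  have "inj_on g F" using g(2) N F(3) by (intro inj_onI) (meson subsetD)
  then have "card F \<le> card C" using g(1) F(3) assms(1) by (intro card_inj_on_le) auto
  then show False using F(2) by simp
qed

definition sh :: "int \<Rightarrow> (int \<Rightarrow> 'a) \<Rightarrow> (int \<Rightarrow> 'a)" where
  "sh c x = (\<lambda>n. x (n + c))"

lemma sh_sh [simp]: "sh c (sh d x) = sh (c + d) x"
  by (simp add: sh_def ac_simps)

lemma sh_0 [simp]: "sh 0 x = x"
  by (simp add: sh_def)

lemma shift_eq_sh: "shift = sh 1"
  by (simp add: shift_def sh_def fun_eq_iff)

lemma sh_apply: "sh c x i = x (i + c)"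
  by (simp add: sh_def)

section \<open>Language and uniform recurrence of a primitive substitution\<close>

locale aperiodic_substitution =
  fixes r :: nat and \<theta> :: "'a::finite \<Rightarrow> 'a list"
  assumes subst: "substitution r \<theta>" and prim: "primitive \<theta>" and inf: "infinite (X_shift r \<theta>)"
begin

abbreviation "X \<equiv> X_shift r \<theta>"
abbreviation "col \<equiv> column r \<theta>"

lemma primitive_column: "\<exists>K. \<forall>a b. \<exists>i<r ^ K. col K i a = b"
  using prim subst_word_power_column[OF subst] unfolding primitive_def by metis

text \<open>For r at most 1 the word \<theta>^K(a) has at most one letter and yet contains every
  letter, so X has at most one point.\<close>

lemma r_ge_2: "r \<ge> 2"
proof (rule ccontr)
  assume "\<not> r \<ge> 2"
  then have "r = 0 \<or> r = 1" by auto
  then have r: "r ^ K \<le> 1" for K by (cases K) auto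
  obtain K where K: "\<forall>a b. \<exists>i<r ^ K. col K i a = b" using primitive_column by blast
  have "b = col K 0 a" for a b
  proof -
    obtain i where "i < r ^ K" "col K i a = b" using K by blast
    moreover from this have "i = 0" using r[of K] by linarith
    ultimately show ?thesis by simp
  qed
  then have "x = y" for x y :: "int \<Rightarrow> 'a" by (metis ext)
  then have "X \<subseteq> {undefined}" by blast
  then show False using inf finite_subset by blast
qed

lemma r_pos: "r > 0" using r_ge_2 by simp

lemma power_r_unbounded: "\<exists>n. N < r ^ n"
  using r_ge_2 by (meson less_exp order_less_le_trans power_mono zero_le)

text \<open>The language of \<theta> itself, as factors of the words \<theta>^k(a). It frees the
  arguments from the periodic point, which \<open>X_shift\<close> lets vary with the
  element.\<close>

definition word :: "nat \<Rightarrow> (nat \<Rightarrow> 'a) \<Rightarrow> bool" where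
  "word n w \<longleftrightarrow> (\<exists>k a j. j + n \<le> r ^ k \<and> (\<forall>m<n. col k (j + m) a = w m))"

lemma subst_seq_power_periodic:
  assumes "(subst_seq r \<theta> ^^ p) u = u" shows "(subst_seq r \<theta> ^^ (p * s)) u = u"
proof (induction s)
  case (Suc s)
  then show ?case using assms by (simp add: funpow_add)
qed simp

text \<open>Since u is fixed by \<theta>^(ps), it begins with \<theta>^(ps)(u 0), and for large s
  this block covers the given positions.\<close>

lemma word_periodic_point:
  assumes "periodic_point r \<theta> u" shows "word n (\<lambda>m. u (j + m))"
proof -
  obtain p where p: "p \<ge> 1" "(subst_seq r \<theta> ^^ p) u = u"
    using assms by (auto simp: periodic_point_def)
  obtain s where s: "j + n < r ^ s" using power_r_unbounded by blast
  have le: "r ^ s \<le> r ^ (p * s)" using p r_ge_2 by (intro power_increasing) auto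
  have u: "u = (\<lambda>i. col (p * s) i (u (i div r ^ (p * s))))"
    using subst_seq_power_periodic[OF p(2), of s] by (simp add: subst_seq_power)
  have "u (j + m) = col (p * s) (j + m) (u 0)" if "m < n" for m
    using fun_cong[OF u, of "j + m"] that s le by simp
  then show ?thesis unfolding word_def using s le
    by (intro exI[of _ "p * s"] exI[of _ "u 0"] exI[of _ j]) auto
qed

text \<open>The word lies in some \<theta>^k(a0), and by primitivity a0 lies in \<theta>^K(a) for
  every a; hence M = k + K works for all letters at once.\<close>

lemma word_in_all_columns:
  assumes "word n w"
  shows "\<exists>M. \<forall>a. \<exists>j. j + n \<le> r ^ M \<and> (\<forall>m<n. col M (j + m) a = w m)"
proof -
  obtain k a0 j where j: "j + n \<le> r ^ k" "\<forall>m<n. col k (j + m) a0 = w m"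
    using assms by (auto simp: word_def)
  obtain K where K: "\<forall>a b. \<exists>i<r ^ K. col K i a = b" using primitive_column by blast
  have "\<exists>j'. j' + n \<le> r ^ (k + K) \<and> (\<forall>m<n. col (k + K) (j' + m) a = w m)" for a
  proof -
    obtain i where i: "i < r ^ K" "col K i a = a0" using K by blast
    have "i * r ^ k + (j + n) \<le> Suc i * r ^ k" using j by simp
    also have "\<dots> \<le> r ^ K * r ^ k" using i by (intro mult_right_mono) auto
    finally have "(i * r ^ k + j) + n \<le> r ^ (k + K)" by (simp add: power_add mult.commute)
    moreover have "col (k + K) (i * r ^ k + j + m) a = w m" if "m < n" for m
    proof -
      have "(i * r ^ k + (j + m)) div r ^ k = i"
        using j(1) that r_pos by simp
      then show ?thesis
        using that i(2) j(2) r_pos by (simp add: column_add add.assoc column_periodic)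
    qed
    ultimately show ?thesis by blast
  qed
  then show ?thesis by blast
qed

lemma desubstitute_periodic_point:
  assumes "periodic_point r \<theta> u"
  shows "\<exists>v. periodic_point r \<theta> v \<and> u = (\<lambda>i. col M i (v (i div r ^ M)))"
proof -
  obtain p where p: "p \<ge> 1" "(subst_seq r \<theta> ^^ p) u = u"
    using assms by (auto simp: periodic_point_def)
  \<comment> \<open>M + (p - 1) M is a multiple of the period p, so \<theta>^M carries this v back
    to u.\<close>
  define v where "v = (subst_seq r \<theta> ^^ ((p - 1) * M)) u"
  have "(subst_seq r \<theta> ^^ p) v = v"
    unfolding v_def using p(2) by (metis add.commute funpow_add o_apply)
  moreover have "(subst_seq r \<theta> ^^ M) v = u"
  proof -
    have "M + (p - 1) * M = p * M" using p(1) by (cases p) auto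
    then have "(subst_seq r \<theta> ^^ M) v = (subst_seq r \<theta> ^^ (p * M)) u"
      unfolding v_def by (metis funpow_add o_apply)
    then show ?thesis using subst_seq_power_periodic[OF p(2)] by simp
  qed
  ultimately show ?thesis using p(1) by (intro exI[of _ v]) (auto simp: periodic_point_def subst_seq_power)
qed

lemma periodic_point_recurrent:
  assumes "word n w"
  shows "\<exists>L. \<forall>u i. periodic_point r \<theta> u \<longrightarrow> (\<exists>j\<ge>i. j + n \<le> i + L \<and> (\<forall>m<n. u (j + m) = w m))"
proof -
  obtain M where M: "\<forall>a. \<exists>j. j + n \<le> r ^ M \<and> (\<forall>m<n. col M (j + m) a = w m)"
    using word_in_all_columns[OF assms] by blast
  have "\<exists>j\<ge>i. j + n \<le> i + 2 * r ^ M \<and> (\<forall>m<n. u (j + m) = w m)" if u: "periodic_point r \<theta> u" for u i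
  proof -
    obtain v where v: "u = (\<lambda>i. col M i (v (i div r ^ M)))"
      using desubstitute_periodic_point[OF u] by blast
    \<comment> \<open>The first aligned block starting after i. It ends within 2 r^M of i, and it
      contains the word whatever its letter is.\<close>
    define q where "q = Suc (i div r ^ M)"
    obtain j where j: "j + n \<le> r ^ M" "\<forall>m<n. col M (j + m) (v q) = w m" using M by blast
    have i: "i < q * r ^ M" "q * r ^ M \<le> i + r ^ M"
      using r_pos unfolding q_def
      by (metis dividend_less_div_times mult_Suc zero_less_power add.commute)
         (metis add.commute add_le_mono1 div_times_less_eq_dividend mult_Suc)
    have "u (q * r ^ M + j + m) = w m" if "m < n" for m
    proof -
      have "(q * r ^ M + (j + m)) div r ^ M = q" using j(1) that r_pos by simp
      then show ?thesis unfolding v using j(2) that r_pos by (simp add: add.assoc column_periodic)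
    qed
    then show ?thesis using i j by (intro exI[of _ "q * r ^ M + j"]) auto
  qed
  then show ?thesis by blast
qed

lemma X_word: "x \<in> X \<Longrightarrow> word n (\<lambda>m. x (i + int m))"
proof -
  assume "x \<in> X"
  then obtain u j where "periodic_point r \<theta> u" "\<forall>m<n. x (i + int m) = u (j + m)"
    unfolding X_shift_def by blast
  then show ?thesis using word_periodic_point[of u n j] unfolding word_def by simp
qed

lemma X_nonempty: "\<exists>x. x \<in> X"
  using inf by (metis ex_in_conv finite.emptyI)

text \<open>By recurrence every word of the language occurs in every periodic point, so one fixed u
  serves all factors of x.\<close>

lemma X_I: assumes "\<And>i n. word n (\<lambda>m. x (i + int m))" shows "x \<in> X"
proof -
  obtain u where u: "periodic_point r \<theta> u" using X_nonempty by (auto simp: X_shift_def)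
  have "\<exists>j. \<forall>m<n. x (i + int m) = u (j + m)" for i n
    using periodic_point_recurrent[OF assms[of n i]] u by metis
  then show ?thesis unfolding X_shift_def using u by auto
qed

lemma X_recurrent:
  assumes "word n w"
  shows "\<exists>L. \<forall>x\<in>X. \<forall>i. \<exists>j\<ge>i. j + int n \<le> i + int L \<and> (\<forall>m<n. x (j + int m) = w m)"
proof -
  obtain L where L: "\<And>u i. periodic_point r \<theta> u \<Longrightarrow> (\<exists>j\<ge>i. j + n \<le> i + L \<and> (\<forall>m<n. u (j + m) = w m))"
    using periodic_point_recurrent[OF assms] by blast
  have "\<exists>j\<ge>i. j + int n \<le> i + int L \<and> (\<forall>m<n. x (j + int m) = w m)" if x: "x \<in> X" for x i
  proof -
    obtain u j where u: "periodic_point r \<theta> u" and j: "\<forall>m<L. x (i + int m) = u (j + m)"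
      using x unfolding X_shift_def by blast
    obtain k where k: "k \<ge> j" "k + n \<le> j + L" "\<forall>m<n. u (k + m) = w m" using L[OF u] by blast
    have "x (i + int (k - j) + int m) = w m" if "m < n" for m
    proof -
      have "k - j + m < L" using k that by simp
      then have "x (i + int (k - j + m)) = u (j + (k - j + m))" using j by blast
      moreover have "i + int (k - j + m) = i + int (k - j) + int m" by simp
      moreover have "j + (k - j + m) = k + m" using k by simp
      ultimately have "x (i + int (k - j) + int m) = u (k + m)" by (simp only:)
      then show ?thesis using k(3) that by simp
    qed
    moreover have "i + int (k - j) \<ge> i" "i + int (k - j) + int n \<le> i + int L" using k by auto
    ultimately show ?thesis by blast
  qed
  then show ?thesis by blast
qed

lemma sh_in_X [simp]: "sh c x \<in> X \<longleftrightarrow> x \<in> X"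
proof -
  have "sh c x \<in> X" if "x \<in> X" for x c
    using X_word[OF that, of _ "_ + c"] by (intro X_I) (simp add: sh_def add.assoc add.commute[of c])
  from this[of x c] this[of "sh c x" "- c"] show ?thesis by auto
qed

lemma X_closed: assumes "\<And>N. \<exists>y\<in>X. agree N x y" shows "x \<in> X"
proof (rule X_I)
  fix i :: int and n
  obtain y where y: "y \<in> X" "agree (nat \<bar>i\<bar> + n) x y" using assms by blast
  have "x (i + int m) = y (i + int m)" if "m < n" for m
    using y(2) that by (auto simp: agree_def)
  then show "word n (\<lambda>m. x (i + int m))" using X_word[OF y(1), of n i] unfolding word_def by simp
qed

lemma agree_returns:
  assumes "y \<in> X"
  shows "\<exists>L. \<forall>x\<in>X. \<forall>i. \<exists>c. i \<le> c \<and> c \<le> i + int L \<and> agree N (sh c x) y"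
proof -
  obtain L where L: "\<forall>x\<in>X. \<forall>i. \<exists>j\<ge>i. j + int (2 * N + 1) \<le> i + int L \<and>
      (\<forall>m<2 * N + 1. x (j + int m) = y (- int N + int m))"
    using X_recurrent[OF X_word[OF assms, of "2 * N + 1" "- int N"]] by blast
  \<comment> \<open>The window is a word of length 2N + 1. An occurrence starting at j is a return
    at its centre j + N, which enlarges the gap from L to L + N.\<close>
  have "\<exists>c. i \<le> c \<and> c \<le> i + int (L + N) \<and> agree N (sh c x) y" if x: "x \<in> X" for x i
  proof -
    obtain j where j: "j \<ge> i" "j + int (2 * N + 1) \<le> i + int L"
      "\<forall>m<2 * N + 1. x (j + int m) = y (- int N + int m)" using L x by metis
    have "agree N (sh (j + int N) x) y" unfolding agree_def sh_def
    proof (intro allI impI)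
      fix k :: int assume "\<bar>k\<bar> \<le> int N"
      then have "nat (k + int N) < 2 * N + 1" "int (nat (k + int N)) = k + int N" by auto
      then have "x (j + int (nat (k + int N))) = y (- int N + int (nat (k + int N)))" using j(3) by blast
      then show "x (k + (j + int N)) = y k"
        using \<open>int (nat (k + int N)) = k + int N\<close> by (simp add: ac_simps)
    qed
    then show ?thesis using j by (intro exI[of _ "j + int N"]) auto
  qed
  then show ?thesis by blast
qed

lemma orbit_dense: "x \<in> X \<Longrightarrow> y \<in> X \<Longrightarrow> \<exists>c. agree N (sh (int c) x) y"
  using agree_returns[of y N] by (metis zero_le_imp_eq_int)

section \<open>Locally constant functions and minimality\<close>

definition locally_constant :: "((int \<Rightarrow> 'a) \<Rightarrow> 'b) \<Rightarrow> bool" where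
  "locally_constant f \<longleftrightarrow> (\<forall>x\<in>X. \<exists>N. \<forall>y\<in>X. agree N y x \<longrightarrow> f y = f x)"

text \<open>Along the forward orbit of x the value does not change, and that orbit enters the window
  around y on which f equals f y.\<close>

lemma invariant_constant:
  assumes lc: "locally_constant f" and sh: "\<And>x. x \<in> X \<Longrightarrow> f (shift x) = f x" and "x \<in> X" "y \<in> X"
  shows "f x = f y"
proof -
  have inv: "f (sh (int c) x) = f x" for c
  proof (induction c)
    case (Suc c)
    then show ?case using sh[of "sh (int c) x"] \<open>x \<in> X\<close> by (simp add: shift_eq_sh)
  qed simp
  obtain N where N: "\<forall>z\<in>X. agree N z y \<longrightarrow> f z = f y"
    using lc \<open>y \<in> X\<close> by (auto simp: locally_constant_def)
  obtain c where "agree N (sh (int c) x) y" using orbit_dense \<open>x \<in> X\<close> \<open>y \<in> X\<close> by blast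
  then show ?thesis using N inv \<open>x \<in> X\<close> by (metis sh_in_X)
qed

lemma X_limit_point:
  fixes I :: "nat set"
  assumes "infinite I" "\<And>n. n \<in> I \<Longrightarrow> f n \<in> X"
  shows "\<exists>g\<in>X. \<forall>N. infinite {n\<in>I. agree N (f n) g}"
proof -
  obtain g where g: "\<And>N. infinite {n\<in>I. agree N (f n) g}" using exists_limit_point[OF assms(1)] by metis
  have "\<exists>y\<in>X. agree N g y" for N
  proof -
    obtain n where "n \<in> {n\<in>I. agree N (f n) g}" using g by (metis ex_in_conv finite.emptyI)
    then show ?thesis using assms(2) agree_sym by blast
  qed
  then show ?thesis using X_closed g by blast
qed

text \<open>Counterexamples on growing windows accumulate at some g; both members of a late pair lie
  in the window around g on which f is constant.\<close>

lemma locally_constant_uniform: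
  assumes "locally_constant f"
  shows "\<exists>N. \<forall>x\<in>X. \<forall>y\<in>X. agree N x y \<longrightarrow> f x = f y"
proof (rule ccontr)
  assume "\<not> ?thesis"
  then have "\<forall>N. \<exists>x y. x \<in> X \<and> y \<in> X \<and> agree N x y \<and> f x \<noteq> f y" by blast
  then obtain x y where xy: "\<And>N. x N \<in> X" "\<And>N. y N \<in> X" "\<And>N. agree N (x N) (y N)" "\<And>N. f (x N) \<noteq> f (y N)"
    by metis
  obtain g where g: "g \<in> X" "\<And>N. infinite {n\<in>UNIV. agree N (x n) g}"
    using X_limit_point[of UNIV x] xy(1) by auto
  obtain N where N: "\<forall>z\<in>X. agree N z g \<longrightarrow> f z = f g"
    using assms g(1) by (auto simp: locally_constant_def)
  obtain n where n: "n \<ge> N" "agree N (x n) g"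
    using g(2)[of N] by (auto simp: infinite_nat_iff_unbounded_le)
  then have "agree N (y n) g"
    using agree_trans[OF agree_sym[OF agree_mono[OF xy(3)[of n] n(1)]]] by blast
  then show False using N n xy by metis
qed

section \<open>Windows and the product topology\<close>

lemma topspace_X_top [simp]: "topspace (X_top r \<theta>) = X"
  by (simp add: X_top_def)

lemma continuous_imp_locally_constant:
  assumes "continuous_map (X_top r \<theta>) (discrete_topology UNIV) f"
  shows "locally_constant f"
  unfolding locally_constant_def
proof
  fix x assume x: "x \<in> X"
  have "openin (X_top r \<theta>) {y \<in> X. f y \<in> {f x}}"
    using openin_continuous_map_preimage[OF assms, of "{f x}"] by simp
  then obtain U where U: "openin (product_topology (\<lambda>_. discrete_topology UNIV) UNIV) U"
    "{y \<in> X. f y \<in> {f x}} = U \<inter> X" by (auto simp: X_top_def openin_subtopology)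
  then have "x \<in> U" using x by auto
  with U(1) obtain V where V: "finite {i. V i \<noteq> (UNIV :: 'a set)}" "x \<in> Pi\<^sub>E UNIV V" "Pi\<^sub>E UNIV V \<subseteq> U"
    unfolding openin_product_topology_alt by fastforce
  \<comment> \<open>A radius reaching all coordinates that the basic open set constrains; the
    inserted 0 covers the case of no constraint.\<close>
  define N where "N = nat (Max (insert 0 (abs ` {i. V i \<noteq> UNIV})))"
  have "f y = f x" if y: "y \<in> X" "agree N y x" for y
  proof -
    have "y i \<in> V i" for i
    proof (cases "V i = UNIV")
      case False
      then have "\<bar>i\<bar> \<le> Max (insert 0 (abs ` {i. V i \<noteq> UNIV}))" using V(1) by (intro Max_ge) auto
      then have "\<bar>i\<bar> \<le> int N" unfolding N_def by linarith
      then have "y i = x i" using y(2) by (simp add: agree_def)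
      then show ?thesis using V(2) by auto
    qed simp
    then have "y \<in> U" using V(3) by auto
    then show ?thesis using U(2) y(1) by blast
  qed
  then show "\<exists>N. \<forall>y\<in>X. agree N y x \<longrightarrow> f y = f x" by blast
qed

lemma openin_cylinder:
  "openin (product_topology (\<lambda>_. discrete_topology UNIV) UNIV) {z. agree N z x}"
proof -
  have "{z. agree N z x} = Pi\<^sub>E UNIV (\<lambda>i. if \<bar>i\<bar> \<le> int N then {x i} else UNIV)"
    by (auto simp: agree_def PiE_def Pi_def split: if_splits)
  moreover have "finite {i::int. \<bar>i\<bar> \<le> int N}"
    by (rule finite_subset[of _ "{- int N..int N}"]) auto
  ultimately show ?thesis
    by (auto simp: openin_PiE_gen intro: finite_subset[rotated])
qed

lemma locally_constant_imp_continuous: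
  assumes "locally_constant f"
  shows "continuous_map (X_top r \<theta>) (discrete_topology UNIV) f"
  unfolding continuous_map_def
proof (intro conjI allI impI)
  fix V
  show "openin (X_top r \<theta>) {x \<in> topspace (X_top r \<theta>). f x \<in> V}"
  proof (subst openin_subopen, safe)
    fix x assume x: "x \<in> topspace (X_top r \<theta>)" "f x \<in> V"
    then obtain N where N: "\<forall>y\<in>X. agree N y x \<longrightarrow> f y = f x"
      using assms by (auto simp: locally_constant_def)
    have "openin (X_top r \<theta>) ({z. agree N z x} \<inter> X)"
      unfolding X_top_def openin_subtopology using openin_cylinder by blast
    moreover have "x \<in> {z. agree N z x} \<inter> X" using x by (simp add: agree_def)
    moreover have "{z. agree N z x} \<inter> X \<subseteq> {x \<in> topspace (X_top r \<theta>). f x \<in> V}"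
      using x(2) N by auto
    ultimately show "\<exists>T. openin (X_top r \<theta>) T \<and> x \<in> T \<and> T \<subseteq> {x \<in> topspace (X_top r \<theta>). f x \<in> V}"
      by blast
  qed
qed simp

lemma sh_continuous: "continuous_map (X_top r \<theta>) (X_top r \<theta>) (sh c)"
proof -
  have "continuous_map (X_top r \<theta>) (product_topology (\<lambda>_. discrete_topology UNIV) UNIV) (sh c)"
  proof (subst continuous_map_componentwise_UNIV, rule allI)
    fix k
    have "locally_constant (\<lambda>x. sh c x k)"
      unfolding locally_constant_def
    proof
      fix x
      show "\<exists>N. \<forall>y\<in>X. agree N y x \<longrightarrow> sh c y k = sh c x k"
        by (rule exI[of _ "nat \<bar>k + c\<bar>"]) (auto simp: agree_def sh_def)
    qed
    then show "continuous_map (X_top r \<theta>) (discrete_topology UNIV) (\<lambda>x. sh c x k)"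
      by (rule locally_constant_imp_continuous)
  qed
  then show ?thesis
    by (subst (2) X_top_def) (auto simp: continuous_map_in_subtopology)
qed

section \<open>Substituting and desubstituting two-sided points\<close>

definition sub :: "nat \<Rightarrow> (int \<Rightarrow> 'a) \<Rightarrow> (int \<Rightarrow> 'a)" where
  "sub n y = (\<lambda>i. col n (nat (i mod int (r ^ n))) (y (i div int (r ^ n))))"

text \<open>The block of y 0 starts at the origin, and floor division cuts negative positions in the
  same way, so shifting y by c moves c whole blocks.\<close>

lemma sub_sh: "sub n (sh c y) = sh (c * int (r ^ n)) (sub n y)"
proof
  fix i
  have nz: "int (r ^ n) \<noteq> 0" using r_pos by simp
  show "sub n (sh c y) i = sh (c * int (r ^ n)) (sub n y) i"
    unfolding sub_def sh_def mod_mult_self1 div_mult_self1[OF nz] add.commute[of c] by (rule refl)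
qed

lemma sub_nat:
  "sub n y (q * int (r ^ n) + int t) = col n t (y (q + int (t div r ^ n)))"
proof -
  have "col n t a = col n (t mod r ^ n) a" for a
    using column_periodic[OF r_pos, of \<theta> n "t div r ^ n" "t mod r ^ n" a]
    by (simp only: div_mult_mod_eq)
  moreover have "nat (int t mod int (r ^ n)) = t mod r ^ n"
    by (metis nat_int zmod_int)
  moreover have "int t div int (r ^ n) = int (t div r ^ n)"
    by (metis zdiv_int)
  moreover have "(q * int (r ^ n) + int t) mod int (r ^ n) = int t mod int (r ^ n)"
    by (metis add.commute mod_mult_self1)
  moreover have "(q * int (r ^ n) + int t) div int (r ^ n) = q + int t div int (r ^ n)"
  proof -
    have "int (r ^ n) \<noteq> 0" using r_pos by simp
    from div_mult_self1[OF this, of "int t" q] show ?thesis by (simp only: add.commute)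
  qed
  ultimately show ?thesis unfolding sub_def by metis
qed

lemma sub_in_X: assumes "y \<in> X" shows "sub n y \<in> X"
proof (rule X_I)
  fix i :: int and l
  define R where "R = r ^ n"
  have R: "R > 0" using r_pos by (simp add: R_def)
  define q t where "q = i div int R" and "t = nat (i mod int R)"
  have t: "t < R" and i: "i = q * int R + int t"
    using R by (auto simp: q_def t_def nat_less_iff)
  obtain k a j where j: "j + Suc l \<le> r ^ k" "\<forall>m<Suc l. col k (j + m) a = y (q + int m)"
    using X_word[OF assms, of "Suc l" q] by (auto simp: word_def)
  \<comment> \<open>The l letters read from offset t < R on lie in the images of l + 1 consecutive
    letters of y.\<close>
  have tl: "t + l \<le> Suc l * R"
  proof -
    have "l \<le> l * R" using R by simp
    then show ?thesis using t unfolding mult_Suc by linarith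
  qed
  have "(j + Suc l) * R \<le> r ^ k * R" using j(1) by (intro mult_right_mono) auto
  then have "j * R + t + l \<le> r ^ (n + k)"
    using tl by (simp add: power_add R_def algebra_simps)
  moreover have "col (n + k) (j * R + t + m) a = sub n y (i + int m)" if m: "m < l" for m
  proof -
    have "t + m < Suc l * R" using tl m by linarith
    then have lt: "(t + m) div R < Suc l" by (rule less_mult_imp_div_less)
    have "sub n y (i + int m) = sub n y (q * int (r ^ n) + int (t + m))"
      using i by (simp add: R_def ac_simps)
    also have "\<dots> = col n (t + m) (y (q + int ((t + m) div R)))"
      unfolding R_def by (rule sub_nat)
    also have "\<dots> = col n (t + m) (col k (j + (t + m) div R) a)" using j(2) lt by simp
    also have "\<dots> = col (n + k) (j * R + (t + m)) a"
      using R r_pos by (simp add: column_add column_periodic flip: R_def) (simp add: R_def column_periodic)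
    finally show ?thesis by (simp add: add.assoc)
  qed
  ultimately show "word l (\<lambda>m. sub n y (i + int m))"
    unfolding word_def by blast
qed

text \<open>The forward orbit of a single point \<theta>^n(y0) is dense. Each shift c splits into
  \<open>c div r ^ n\<close> block shifts and an offset \<open>c mod r ^ n\<close>. Only finitely
  many offsets occur, so along a subsequence the offset is constant and the desubstituted points
  accumulate.\<close>

lemma desubstitute:
  assumes "x \<in> X" shows "\<exists>m y. m < r ^ n \<and> y \<in> X \<and> x = sh (int m) (sub n y)"
proof -
  obtain y0 where y0: "y0 \<in> X" using X_nonempty by blast
  have "\<forall>N. \<exists>c. agree N (sh (int c) (sub n y0)) x"
    using orbit_dense[OF sub_in_X[OF y0] assms] by blast
  then obtain c where c: "\<And>N. agree N (sh (int (c N)) (sub n y0)) x" by metis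
  define t where "t N = c N mod r ^ n" for N
  define y where "y N = sh (int (c N div r ^ n)) y0" for N
  have shc: "sh (int (c N)) (sub n y0) = sh (int (t N)) (sub n (y N))" for N
    unfolding y_def t_def sub_sh sh_sh
    by (metis add.commute div_mult_mod_eq of_nat_add of_nat_mult)
  have t: "t N < r ^ n" for N using r_pos by (simp add: t_def)
  then have "finite (range t)" by (intro finite_subset[of "range t" "{..<r ^ n}"]) auto
  then obtain N0 where I: "infinite {N. t N = t N0}"
    using pigeonhole_infinite[of UNIV t] by auto
  define m where "m = t N0"
  obtain g where g: "g \<in> X" "\<And>M. infinite {N\<in>{N. t N = m}. agree M (y N) g}"
    using X_limit_point[OF I, of y] y0 unfolding y_def m_def by auto
  have "x i = sh (int m) (sub n g) i" for i
  proof -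
    define e where "e = (i + int m) div int (r ^ n)"
    obtain N where N: "N \<ge> nat \<bar>i\<bar>" "t N = m" "agree (nat \<bar>e\<bar>) (y N) g"
      using g(2)[of "nat \<bar>e\<bar>"] unfolding infinite_nat_iff_unbounded_le by blast
    have "x i = sh (int (c N)) (sub n y0) i" using c[of N] N(1) by (auto simp: agree_def)
    also have "\<dots> = sub n (y N) (i + int m)" using N(2) by (simp add: shc sh_apply)
    also have "\<dots> = sub n g (i + int m)"
      using N(3) unfolding sub_def e_def[symmetric] by (auto simp: agree_def)
    finally show ?thesis by (simp add: sh_apply)
  qed
  then show ?thesis using t g(1) unfolding m_def by blast
qed

text \<open>For |i| < r^n the position i + m lies strictly between -r^n and 2 r^n, hence in the
  blocks of the letters at -1, 0 and 1.\<close>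

lemma sub_window:
  assumes "y (-1) = y' (-1)" "y 0 = y' 0" "y 1 = y' 1" "m < r ^ n"
  shows "agree (r ^ n - 1) (sh (int m) (sub n y)) (sh (int m) (sub n y'))"
  unfolding agree_def
proof (intro allI impI)
  fix i :: int assume i: "\<bar>i\<bar> \<le> int (r ^ n - 1)"
  define R where "R = int (r ^ n)"
  have R: "\<bar>i\<bar> < R" "0 < R" "int m < R" using i r_pos assms(4) unfolding R_def
    by (auto simp: of_nat_diff)
  define e where "e = (i + int m) div R"
  have e: "e * R \<le> i + int m" "i + int m < e * R + R"
    using R(2) div_mult_mod_eq[of "i + int m" R] pos_mod_bound[of R "i + int m"]
      pos_mod_sign[of R "i + int m"] unfolding e_def by linarith+
  have "\<not> e \<ge> 2"
  proof
    assume "e \<ge> 2"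
    then have "2 * R \<le> e * R" using R(2) by (intro mult_right_mono) auto
    then show False using e R by linarith
  qed
  moreover have "\<not> e \<le> -2"
  proof
    assume "e \<le> -2"
    then have "e * R \<le> -2 * R" using R(2) by (intro mult_right_mono) auto
    then show False using e R by linarith
  qed
  ultimately have "(i + int m) div R \<in> {-1, 0, 1}" unfolding e_def by auto
  then show "sh (int m) (sub n y) i = sh (int m) (sub n y') i"
    using assms(1-3) unfolding sub_def sh_apply R_def[symmetric] by auto
qed

text \<open>The last disagreement is pinned at -1, which selects one representative from each shift
  orbit of right-asymptotic pairs; only then can the set be finite.\<close>

definition asymptotic_pairs :: "((int \<Rightarrow> 'a) \<times> (int \<Rightarrow> 'a)) set" where
  "asymptotic_pairs = {(x, y). x \<in> X \<and> y \<in> X \<and> (\<forall>i\<ge>0. x i = y i) \<and> x (-1) \<noteq> y (-1)}"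

text \<open>Pairs violating this for growing N accumulate at an asymptotic pair. Each pair is
  treated as one sequence over pairs of letters, so that both limits are taken along the same
  subsequence.\<close>

lemma left_determined_if_no_asymptotic_pairs:
  assumes "asymptotic_pairs = {}"
  shows "\<exists>N. \<forall>x\<in>X. \<forall>y\<in>X. (\<forall>i. 0 \<le> i \<and> i < int N \<longrightarrow> x i = y i) \<longrightarrow> x (-1) = y (-1)"
proof (rule ccontr)
  assume "\<not> ?thesis"
  then have "\<forall>N. \<exists>p. fst p \<in> X \<and> snd p \<in> X \<and> (\<forall>i. 0 \<le> i \<and> i < int N \<longrightarrow> fst p i = snd p i) \<and>
      fst p (-1) \<noteq> snd p (-1)" by (metis fst_conv snd_conv)
  then obtain p where p: "\<And>N. fst (p N) \<in> X" "\<And>N. snd (p N) \<in> X"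
    "\<And>N i. 0 \<le> i \<Longrightarrow> i < int N \<Longrightarrow> fst (p N) i = snd (p N) i"
    "\<And>N. fst (p N) (-1) \<noteq> snd (p N) (-1)" by metis
  obtain g where g: "\<And>N. infinite {n\<in>UNIV. agree N (\<lambda>i. (fst (p n) i, snd (p n) i)) g}"
    using exists_limit_point[of UNIV "\<lambda>n i. (fst (p n) i, snd (p n) i)"] by auto
  define x y where "x = fst \<circ> g" and "y = snd \<circ> g"
  have lim: "\<exists>n\<ge>M. agree N x (fst (p n)) \<and> agree N y (snd (p n))" for N M
  proof -
    obtain n where n: "n \<ge> M" "agree N (\<lambda>i. (fst (p n) i, snd (p n) i)) g"
      using g[of N] unfolding infinite_nat_iff_unbounded_le by auto
    then show ?thesis
      by (intro exI[of _ n]) (auto simp: agree_def x_def y_def fst_def snd_def split: prod.splits)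
  qed
  have "x \<in> X" "y \<in> X" using lim p by (metis X_closed)+
  moreover have "x i = y i" if "i \<ge> 0" for i
  proof -
    obtain n where "n \<ge> nat i + 1" "agree (nat i) x (fst (p n))" "agree (nat i) y (snd (p n))"
      using lim by blast
    then show ?thesis using p(3)[of i n] that by (auto simp: agree_def)
  qed
  moreover have "x (-1) \<noteq> y (-1)"
  proof -
    obtain n where "agree 1 x (fst (p n))" "agree 1 y (snd (p n))" using lim by blast
    then show ?thesis using p(4)[of n] by (auto simp: agree_def)
  qed
  ultimately show False using assms by (auto simp: asymptotic_pairs_def)
qed

text \<open>Otherwise L consecutive letters determine everything to their left, and X is coded by
  words of length L, contradicting its infinity.\<close>

lemma asymptotic_pairs_nonempty: "asymptotic_pairs \<noteq> {}"
proof
  assume "asymptotic_pairs = {}"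
  then obtain L where L: "\<And>x y. x \<in> X \<Longrightarrow> y \<in> X \<Longrightarrow> (\<forall>i. 0 \<le> i \<and> i < int L \<longrightarrow> x i = y i) \<Longrightarrow> x (-1) = y (-1)"
    using left_determined_if_no_asymptotic_pairs by metis
  \<comment> \<open>Strong induction, because the L letters following the new position may include
    several of the letters already determined as well as letters of the given window.\<close>
  have left: "x (c - 1 - int d) = y (c - 1 - int d)"
    if xy: "x \<in> X" "y \<in> X" "\<forall>i. c \<le> i \<and> i < c + int L \<longrightarrow> x i = y i" for x y c d
  proof (induction d rule: less_induct)
    case (less d)
    have "sh (c - int d) x (-1) = sh (c - int d) y (-1)"
    proof (rule L)
      show "\<forall>i. 0 \<le> i \<and> i < int L \<longrightarrow> sh (c - int d) x i = sh (c - int d) y i"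
      proof (intro allI impI)
        fix i assume i: "0 \<le> i \<and> i < int L"
        show "sh (c - int d) x i = sh (c - int d) y i"
        proof (cases "i < int d")
          case True
          define e where "e = nat (int d - 1 - i)"
          have "e < d" "c - 1 - int e = i + (c - int d)" using True i by (auto simp: e_def)
          then show ?thesis using less[of e] by (simp only: sh_apply)
        next
          case False
          then show ?thesis using xy(3) i by (auto simp: sh_apply)
        qed
      qed
    qed (use xy in auto)
    then show ?case by (simp add: sh_apply algebra_simps)
  qed
  have "finite X"
  proof (rule finite_if_finitely_coded)
    show "finite (Pi\<^sub>E {0..<L} (\<lambda>_. UNIV) :: (nat \<Rightarrow> 'a) set)" by (intro finite_PiE) auto
    fix N
    let ?g = "\<lambda>x :: int \<Rightarrow> 'a. restrict (\<lambda>m. x (int N + 1 + int m)) {0..<L}"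
    have "agree N x y" if xy: "x \<in> X" "y \<in> X" and eq: "?g x = ?g y" for x y
      unfolding agree_def
    proof (intro allI impI)
      fix i :: int assume i: "\<bar>i\<bar> \<le> int N"
      have "x k = y k" if "int N + 1 \<le> k \<and> k < int N + 1 + int L" for k
      proof -
        define m where "m = nat (k - int N - 1)"
        have "m < L" "k = int N + 1 + int m" using that by (auto simp: m_def)
        then show ?thesis using fun_cong[OF eq, of m] by simp
      qed
      then have "x (int N + 1 - 1 - int (nat (int N - i))) = y (int N + 1 - 1 - int (nat (int N - i)))"
        by (intro left[OF xy]) auto
      moreover have "int N + 1 - 1 - int (nat (int N - i)) = i" using i by linarith
      ultimately show "x i = y i" by (simp only:)
    qed
    then show "\<exists>g. g ` X \<subseteq> (Pi\<^sub>E {0..<L} (\<lambda>_. UNIV) :: (nat \<Rightarrow> 'a) set) \<and> (\<forall>x\<in>X. \<forall>y\<in>X. g x = g y \<longrightarrow> agree N x y)"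
      by (intro exI[of _ ?g]) auto
  qed
  then show False using inf by simp
qed

end

section \<open>Abelian groups that are finite extensions of a cyclic group\<close>

text \<open>The map f separates the cosets of the subgroup generated by s, which bounds its index by
  card Z. Raising to a suitable power d maps the whole group into this copy of \<int>, injectively
  by torsion-freeness, and subgroups of \<int> are cyclic.\<close>

lemma (in comm_group) infinite_cyclic_of_finite_index:
  assumes s: "s \<in> carrier G" and s_inf: "\<And>i::int. s [^] i = \<one> \<Longrightarrow> i = 0"
    and torsion_free: "\<And>x (n::int). x \<in> carrier G \<Longrightarrow> n > 0 \<Longrightarrow> x [^] n = \<one> \<Longrightarrow> x = \<one>"
    and Z: "finite Z" "f ` carrier G \<subseteq> Z"
    and cosets: "\<And>x y. x \<in> carrier G \<Longrightarrow> y \<in> carrier G \<Longrightarrow> f x = f y \<Longrightarrow> \<exists>i::int. x = s [^] i \<otimes> y"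
  shows "\<exists>g\<in>carrier G. \<exists>k>0. carrier G = range (\<lambda>n::int. g [^] n) \<and> g [^] (k::nat) = s"
proof -
  \<comment> \<open>Pigeonholing the powers of x gives a positive exponent j - i \<le> card Z that
    leads into the subgroup. It depends on x; the factorial is a common multiple.\<close>
  define d where "d = int (fact (card Z))"
  have d: "d > 0" by (simp add: d_def)
  have ex_power: "\<exists>c::int. x [^] d = s [^] c" if x: "x \<in> carrier G" for x
  proof -
    let ?h = "\<lambda>i::nat. f (x [^] i)"
    have "card (?h ` {..card Z}) \<le> card Z" using Z x by (intro card_mono) auto
    then have "\<not> inj_on ?h {..card Z}" using card_image[of ?h "{..card Z}"] by auto
    then obtain i j where ij: "i < j" "j \<le> card Z" "f (x [^] j) = f (x [^] i)"
      unfolding inj_on_def by (metis atMost_iff linorder_neqE_nat)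
    then obtain c :: int where "x [^] j = s [^] c \<otimes> x [^] i" using cosets x by (metis nat_pow_closed)
    moreover have "x [^] j = x [^] (j - i) \<otimes> x [^] i" using x ij(1) by (simp add: nat_pow_mult)
    ultimately have c: "x [^] int (j - i) = s [^] c"
      using x s by (metis int_pow_closed int_pow_int nat_pow_closed right_cancel)
    have "(j - i) dvd fact (card Z)" using ij by (intro dvd_fact) auto
    then obtain e where "fact (card Z) = (j - i) * e" by (elim dvdE)
    then have "d = int (j - i) * int e" unfolding d_def by (metis of_nat_mult)
    then have "x [^] d = s [^] (c * int e)" using x s c by (metis int_pow_pow)
    then show ?thesis by blast
  qed
  define P where "P c \<longleftrightarrow> (\<exists>x\<in>carrier G. x [^] d = s [^] c)" for c :: int
  define n where "n = (LEAST n::nat. n > 0 \<and> P (int n))"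
  have "P d" using s by (auto simp: P_def)
  then have "nat d > 0 \<and> P (int (nat d))" using d by simp
  then have n: "n > 0" "P (int n)" unfolding n_def by (metis (mono_tags, lifting) LeastI)+
  have n_least: "m \<ge> n" if "m > 0" "P (int m)" for m
    unfolding n_def using that by (intro Least_le) auto
  obtain g where g: "g \<in> carrier G" "g [^] d = s [^] int n" using n(2) by (auto simp: P_def)
  \<comment> \<open>Dividing by n leaves y with y^d = s^(c mod n). Minimality of n makes the
    remainder vanish, and torsion-freeness then makes y trivial.\<close>
  have gen: "c mod int n = 0 \<and> x = g [^] (c div int n)"
    if x: "x \<in> carrier G" and c: "x [^] d = s [^] c" for x and c :: int
  proof -
    define y where "y = x \<otimes> g [^] (- (c div int n))"
    have y: "y \<in> carrier G" using x g by (simp add: y_def)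
    have "y [^] d = x [^] d \<otimes> (g [^] (- (c div int n))) [^] d"
      unfolding y_def using x g by (intro int_pow_distrib) auto
    also have "(g [^] (- (c div int n))) [^] d = (g [^] d) [^] (- (c div int n))"
      using g(1) by (simp add: int_pow_pow mult.commute)
    also have "\<dots> = s [^] (int n * (- (c div int n)))" using g(2) s by (simp add: int_pow_pow)
    also have "x [^] d \<otimes> \<dots> = s [^] (c + int n * (- (c div int n)))"
      unfolding c by (rule int_pow_mult[OF s, symmetric])
    also have "c + int n * (- (c div int n)) = c mod int n"
      by (simp add: minus_mult_div_eq_mod)
    finally have yd: "y [^] d = s [^] (c mod int n)" .
    then have "P (c mod int n)" using y by (auto simp: P_def)
    moreover have "0 \<le> c mod int n" "c mod int n < int n" using n(1) by simp_all
    ultimately have 0: "c mod int n = 0"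
      using n_least[of "nat (c mod int n)"] by (cases "c mod int n = 0") (simp_all add: nat_less_iff)
    then have "y = \<one>" using yd d y by (intro torsion_free[of y d]) auto
    then have "x \<otimes> g [^] (- (c div int n)) = \<one>" by (simp add: y_def)
    then have "x = inv (g [^] (- (c div int n)))" using x g(1) by (intro inv_equality[symmetric]) auto
    then have "x = g [^] (c div int n)" using g(1) by (simp add: int_pow_neg)
    with 0 show ?thesis by blast
  qed
  have "carrier G = range (\<lambda>m::int. g [^] m)"
  proof
    show "carrier G \<subseteq> range (\<lambda>m::int. g [^] m)" using gen ex_power by blast
    show "range (\<lambda>m::int. g [^] m) \<subseteq> carrier G" using g(1) by auto
  qed
  \<comment> \<open>Apply \<open>gen\<close> to s itself, whose exponent is d; positivity of the
    quotient makes k a positive natural number.\<close>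
  moreover have "s = g [^] nat (d div int n)" "nat (d div int n) > 0"
  proof -
    have *: "d mod int n = 0" "s = g [^] (d div int n)" using gen[of s d] s by auto
    from * d n(1) have "d div int n > 0"
      by (metis mod_0_imp_dvd of_nat_0_less_iff pos_imp_zdiv_pos_iff zdvd_imp_le)
    with *(2) show "s = g [^] nat (d div int n)" "nat (d div int n) > 0"
      using int_pow_int[of G g "nat (d div int n)"] by auto
  qed
  ultimately show ?thesis using g(1) by metis
qed

text \<open>The hypotheses present the group as \<int>^2 modulo the vector (h, -k). Its torsion is
  generated by this vector divided by gcd(k, h), so it vanishes exactly in the coprime case.\<close>

lemma (in comm_group) cyclic_iff_coprime_relation:
  fixes k h :: nat
  assumes s: "s \<in> carrier G" and p: "p \<in> carrier G" and h: "h > 0"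
    and gen: "\<And>x. x \<in> carrier G \<Longrightarrow> \<exists>(i::int) n::int. x = s [^] i \<otimes> p [^] n"
    and rel: "s [^] h = p [^] k"
    and s_p: "\<And>(i::int) n::int. s [^] i = p [^] n \<Longrightarrow> int h dvd i"
    and p_inf: "\<And>n::int. p [^] n = \<one> \<Longrightarrow> n = 0"
  shows "cyclic_group G \<longleftrightarrow> gcd k h = 1"
proof
  have rel': "s [^] int h = p [^] int k" using rel by (simp add: int_pow_int)

  show "cyclic_group G" if cop: "gcd k h = 1"
  proof -
    obtain u v :: int where uv: "u * int k + v * int h = 1"
      using bezout_int[of "int k" "int h"] cop by auto
    \<comment> \<open>The Bezout coefficients are chosen so that g^h = p and g^k = s.\<close>
    define g where "g = s [^] u \<otimes> p [^] v"
    have g: "g \<in> carrier G" using s p by (simp add: g_def)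
    have g_pow: "g [^] m = s [^] (u * m) \<otimes> p [^] (v * m)" for m :: int
      unfolding g_def using s p by (simp add: int_pow_distrib int_pow_pow)
    have "g [^] int h = p"
    proof -
      have "s [^] (u * int h) = p [^] (u * int k)"
        using rel' s p by (metis int_pow_pow mult.commute)
      then have "g [^] int h = p [^] (u * int k + v * int h)" using g_pow p by (simp add: int_pow_mult)
      then show ?thesis using uv p by simp
    qed
    moreover have "g [^] int k = s"
    proof -
      have "p [^] (v * int k) = s [^] (v * int h)"
        using rel' s p by (metis int_pow_pow mult.commute)
      then have "g [^] int k = s [^] (u * int k + v * int h)" using g_pow s by (simp add: int_pow_mult)
      then show ?thesis using uv s by simp
    qed
    ultimately have "s [^] i \<otimes> p [^] n = g [^] (int k * i + int h * n)" for i n :: int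
      using g by (metis int_pow_mult int_pow_pow)
    then have "carrier G \<subseteq> range (\<lambda>n::int. g [^] n)" using gen by blast
    then show ?thesis unfolding cyclic_group using g by (intro bexI[of _ g]) auto
  qed
  show "gcd k h = 1" if cyc: "cyclic_group G"
  proof -
    obtain g where g: "g \<in> carrier G" "carrier G = range (\<lambda>n::int. g [^] n)"
      using cyc by (auto simp: cyclic_group)
    define d where "d = gcd k h"
    obtain k' h' where kh: "k = d * k'" "h = d * h'" unfolding d_def by (meson dvdE gcd_dvd1 gcd_dvd2)
    have d: "d > 0" "h' > 0" using h kh by (auto intro!: Nat.gr0I)
    \<comment> \<open>The relation divided by d: y^d = 1. A cyclic group containing p, of infinite
      order, has no torsion, so y = 1, and then h divides h' = h/d.\<close>
    define y where "y = s [^] int h' \<otimes> p [^] (- int k')"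
    have y: "y \<in> carrier G" using s p by (simp add: y_def)
    obtain m a :: int where m: "y = g [^] m" and a: "p = g [^] a" using g(2) y p by blast
    have "y [^] int d = s [^] int h \<otimes> p [^] (- int k)"
      unfolding y_def using s p kh by (simp add: int_pow_distrib int_pow_pow mult.commute)
    also have "\<dots> = \<one>" using rel' p by (simp flip: int_pow_mult)
    finally have "g [^] (m * int d) = \<one>" using m g(1) by (simp add: int_pow_pow)
    then have "p [^] (m * int d) = \<one>" using a g(1)
      by (metis int_pow_one int_pow_pow mult.commute)
    then have "m = 0" using p_inf d by fastforce
    then have "y = \<one>" using m by simp
    then have "s [^] int h' = p [^] int k'"
      using s p unfolding y_def int_pow_neg[OF p] by (metis int_pow_closed inv_closed inv_equality inv_inv)
    then have "int h dvd int h'" by (rule s_p)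
    then have "h dvd h'" by simp
    then have "d * h' \<le> 1 * h'" using d dvd_imp_le kh by auto
    then show ?thesis using d unfolding d_def[symmetric] by simp
  qed
qed

section \<open>Automorphism groups\<close>

lemma Aut_carrier_iff:
  "f \<in> carrier (Aut X S) \<longleftrightarrow> f \<in> extensional (topspace X) \<and> homeomorphic_map X X f \<and>
     (\<forall>x\<in>topspace X. f (S x) = S (f x))"
  by (auto simp: Aut_def Bij_def bij_betw_def homeomorphic_eq_everything_map)

lemma Aut_closed: "f \<in> carrier (Aut X S) \<Longrightarrow> x \<in> topspace X \<Longrightarrow> f x \<in> topspace X"
  by (auto simp: Aut_carrier_iff homeomorphic_eq_everything_map)

lemma Aut_mult:
  "f \<in> carrier (Aut X S) \<Longrightarrow> g \<in> carrier (Aut X S) \<Longrightarrow> f \<otimes>\<^bsub>Aut X S\<^esub> g = compose (topspace X) f g"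
  by (simp add: Aut_def BijGroup_def)

lemma Aut_mult_apply:
  "f \<in> carrier (Aut X S) \<Longrightarrow> g \<in> carrier (Aut X S) \<Longrightarrow> x \<in> topspace X \<Longrightarrow>
    (f \<otimes>\<^bsub>Aut X S\<^esub> g) x = f (g x)"
  by (simp add: Aut_mult compose_def)

lemma Aut_one: "\<one>\<^bsub>Aut X S\<^esub> = (\<lambda>x\<in>topspace X. x)"
  by (simp add: Aut_def BijGroup_def)

lemma Aut_eqI:
  "f \<in> carrier (Aut X S) \<Longrightarrow> g \<in> carrier (Aut X S) \<Longrightarrow> (\<And>x. x \<in> topspace X \<Longrightarrow> f x = g x) \<Longrightarrow> f = g"
  by (auto simp: Aut_carrier_iff intro: extensionalityI)

lemma group_Aut:
  assumes S: "\<And>x. x \<in> topspace X \<Longrightarrow> S x \<in> topspace X"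
  shows "group (Aut X S)"
proof (rule groupI)
  let ?G = "Aut X S"
  show mult: "f \<otimes>\<^bsub>?G\<^esub> g \<in> carrier ?G" if f: "f \<in> carrier ?G" and g: "g \<in> carrier ?G" for f g
  proof -
    have "homeomorphic_map X X (compose (topspace X) f g)"
      by (rule homeomorphic_map_eq[OF homeomorphic_map_compose[of X X g X f]])
        (use f g in \<open>auto simp: Aut_carrier_iff compose_def\<close>)
    then show ?thesis
      using f g S Aut_closed[OF g] by (auto simp: Aut_mult Aut_carrier_iff compose_def)
  qed
  have id: "homeomorphic_map X X (\<lambda>x\<in>topspace X. x)"
    by (rule homeomorphic_map_eq[of X X id]) auto
  show one: "\<one>\<^bsub>?G\<^esub> \<in> carrier ?G"
    using S id by (auto simp: Aut_one Aut_carrier_iff)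
  show "f \<otimes>\<^bsub>?G\<^esub> g \<otimes>\<^bsub>?G\<^esub> k = f \<otimes>\<^bsub>?G\<^esub> (g \<otimes>\<^bsub>?G\<^esub> k)"
    if "f \<in> carrier ?G" "g \<in> carrier ?G" "k \<in> carrier ?G" for f g k
    using that by (intro Aut_eqI[of _ X S]) (auto simp: Aut_mult_apply mult Aut_closed)
  show "\<one>\<^bsub>?G\<^esub> \<otimes>\<^bsub>?G\<^esub> f = f" if "f \<in> carrier ?G" for f
    using that one by (intro Aut_eqI[of _ X S]) (auto simp: Aut_mult_apply mult Aut_closed Aut_one)
  show "\<exists>g\<in>carrier ?G. g \<otimes>\<^bsub>?G\<^esub> f = \<one>\<^bsub>?G\<^esub>" if f: "f \<in> carrier ?G" for f
  proof -
    obtain g0 where g0: "homeomorphic_maps X X f g0"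
      using f by (auto simp: Aut_carrier_iff homeomorphic_map_maps)
    define g where "g = restrict g0 (topspace X)"
    have "homeomorphic_map X X g0" using g0 homeomorphic_maps_map by blast
    then have "homeomorphic_map X X g" unfolding g_def by (rule homeomorphic_map_eq) simp
    moreover have "g (S x) = S (g x)" if x: "x \<in> topspace X" for x
    proof -
      have "g0 x \<in> topspace X" using g0 x by (auto simp: homeomorphic_maps_def continuous_map_def)
      moreover have "f (g0 x) = x" using g0 x by (auto simp: homeomorphic_maps_def)
      ultimately have "S x = f (S (g0 x))" "S (g0 x) \<in> topspace X" using f S by (auto simp: Aut_carrier_iff)
      then have "g0 (S x) = S (g0 x)" using g0 by (metis homeomorphic_maps_def)
      then show ?thesis using x S by (simp add: g_def)
    qed
    ultimately have "g \<in> carrier ?G" by (auto simp: Aut_carrier_iff g_def)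
    moreover have "g \<otimes>\<^bsub>?G\<^esub> f = \<one>\<^bsub>?G\<^esub>"
      using calculation f one mult g0
      by (intro Aut_eqI[of _ X S]) (auto simp: Aut_mult_apply Aut_one g_def homeomorphic_maps_def Aut_closed)
    ultimately show ?thesis by blast
  qed
qed

section \<open>Automorphisms of the substitution shift\<close>

context aperiodic_substitution
begin

abbreviation "G \<equiv> Aut (X_top r \<theta>) shift"
abbreviation "\<sigma> \<equiv> restrict shift X"

sublocale Aut: group G
  by (rule group_Aut) (simp add: shift_eq_sh)

lemma Aut_X: "\<Phi> \<in> carrier G \<Longrightarrow> x \<in> X \<Longrightarrow> \<Phi> x \<in> X"
  using Aut_closed[of \<Phi> "X_top r \<theta>" shift x] by simp

lemma Aut_sh_nat: "\<Phi> \<in> carrier G \<Longrightarrow> x \<in> X \<Longrightarrow> \<Phi> (sh (int c) x) = sh (int c) (\<Phi> x)"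
proof (induction c)
  case (Suc c)
  have "\<Phi> (sh 1 y) = sh 1 (\<Phi> y)" if "y \<in> X" for y
    using Suc.prems(1) that by (simp add: Aut_carrier_iff shift_eq_sh)
  from this[of "sh (int c) x"] show ?case using Suc by simp
qed simp

lemma Aut_sh: assumes "\<Phi> \<in> carrier G" "x \<in> X" shows "\<Phi> (sh c x) = sh c (\<Phi> x)"
proof (cases "c \<ge> 0")
  case True
  then show ?thesis using Aut_sh_nat[OF assms, of "nat c"] by simp
next
  case False
  then have "sh (- c) (\<Phi> (sh c x)) = \<Phi> x"
    using Aut_sh_nat[OF assms(1), of "sh c x" "nat (- c)"] assms(2) by simp
  then show ?thesis by (metis sh_sh add.right_inverse sh_0)
qed

lemma restrict_sh_Aut: "restrict (sh c) X \<in> carrier G"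
proof -
  have "homeomorphic_maps (X_top r \<theta>) (X_top r \<theta>) (sh c) (sh (- c))"
    by (auto simp: homeomorphic_maps_def sh_continuous)
  then have "homeomorphic_map (X_top r \<theta>) (X_top r \<theta>) (sh c)" by (rule homeomorphic_maps_imp_map)
  then have "homeomorphic_map (X_top r \<theta>) (X_top r \<theta>) (restrict (sh c) X)"
    by (rule homeomorphic_map_eq) simp
  then show ?thesis by (auto simp: Aut_carrier_iff shift_eq_sh add.commute)
qed

lemma \<sigma>_Aut: "\<sigma> \<in> carrier G"
  using restrict_sh_Aut[of 1] by (simp add: shift_eq_sh)

lemma \<sigma>_int_pow: "\<sigma> [^]\<^bsub>G\<^esub> c = restrict (sh c) X" for c :: int
proof -
  have add: "restrict (sh c) X \<otimes>\<^bsub>G\<^esub> restrict (sh d) X = restrict (sh (c + d)) X" for c d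
    by (rule Aut_eqI[of _ "X_top r \<theta>" shift])
       (auto simp: restrict_sh_Aut Aut_mult_apply)
  have one: "restrict (sh 0) X = \<one>\<^bsub>G\<^esub>" by (rule ext) (simp add: Aut_one)
  have nat: "\<sigma> [^]\<^bsub>G\<^esub> n = restrict (sh (int n)) X" for n :: nat
  proof (induction n)
    case 0
    then show ?case using one by (simp only: Aut.nat_pow_0 of_nat_0)
  next
    case (Suc n)
    have "\<sigma> [^]\<^bsub>G\<^esub> Suc n = restrict (sh (int n)) X \<otimes>\<^bsub>G\<^esub> restrict (sh 1) X"
      by (simp only: Aut.nat_pow_Suc Suc.IH) (simp only: shift_eq_sh)
    also have "\<dots> = restrict (sh (int (Suc n))) X" by (simp only: add of_nat_Suc add.commute)
    finally show ?case .
  qed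
  show ?thesis
  proof (cases "c \<ge> 0")
    case True
    then show ?thesis using nat[of "nat c"] by (metis int_nat_eq int_pow_int)
  next
    case False
    have "restrict (sh c) X \<otimes>\<^bsub>G\<^esub> restrict (sh (- c)) X = \<one>\<^bsub>G\<^esub>" using add[of c "- c"] one by simp
    then have "restrict (sh c) X = inv\<^bsub>G\<^esub> (restrict (sh (- c)) X)"
      using restrict_sh_Aut by (metis Aut.inv_equality)
    also have "restrict (sh (- c)) X = \<sigma> [^]\<^bsub>G\<^esub> nat (- c)" using nat[of "nat (- c)"] False by simp
    also have "inv\<^bsub>G\<^esub> (\<sigma> [^]\<^bsub>G\<^esub> nat (- c)) = \<sigma> [^]\<^bsub>G\<^esub> c"
      using False Aut.int_pow_neg_int[OF \<sigma>_Aut, of "nat (- c)"] by simp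
    finally show ?thesis by (rule sym)
  qed
qed

lemma Aut_coordinate:
  assumes "\<Phi> \<in> carrier G" shows "locally_constant (\<lambda>x. \<Phi> x i)"
proof -
  have "continuous_map (X_top r \<theta>) (X_top r \<theta>) \<Phi>"
    using assms homeomorphic_imp_continuous_map by (auto simp: Aut_carrier_iff)
  then have "continuous_map (X_top r \<theta>) (product_topology (\<lambda>_. discrete_topology UNIV) UNIV) \<Phi>"
    by (metis X_top_def continuous_map_in_subtopology)
  then have "continuous_map (X_top r \<theta>) (discrete_topology UNIV) (\<lambda>x. \<Phi> x i)"
    by (subst (asm) continuous_map_componentwise_UNIV) auto
  then show ?thesis by (rule continuous_imp_locally_constant)
qed

text \<open>Equality at x spreads along the forward orbit by commutation with the shift, and from
  this dense set to X by continuity of each coordinate.\<close>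

lemma Aut_determined_by_point:
  assumes "\<Phi> \<in> carrier G" "\<Psi> \<in> carrier G" "x \<in> X" "\<Phi> x = \<Psi> x"
  shows "\<Phi> = \<Psi>"
proof (rule Aut_eqI[OF assms(1,2)])
  fix y assume "y \<in> topspace (X_top r \<theta>)"
  then have y: "y \<in> X" by simp
  show "\<Phi> y = \<Psi> y"
  proof
    fix i
    obtain M where M: "\<forall>z\<in>X. agree M z y \<longrightarrow> \<Phi> z i = \<Phi> y i"
      using Aut_coordinate[OF assms(1), of i] y by (auto simp: locally_constant_def)
    obtain N where N: "\<forall>z\<in>X. agree N z y \<longrightarrow> \<Psi> z i = \<Psi> y i"
      using Aut_coordinate[OF assms(2), of i] y by (auto simp: locally_constant_def)
    obtain c where c: "agree (max M N) (sh (int c) x) y" using orbit_dense[OF assms(3) y] by blast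
    have "\<Phi> y i = \<Phi> (sh (int c) x) i" using M agree_mono[OF c, of M] assms(3) by simp
    also have "\<dots> = \<Psi> (sh (int c) x) i" using assms by (simp add: Aut_sh)
    also have "\<dots> = \<Psi> y i" using N agree_mono[OF c, of N] assms(3) by simp
    finally show "\<Phi> y i = \<Psi> y i" .
  qed
qed

end

section \<open>The homomorphism to the \<open>r\<close>-adic integers\<close>

lemma radic_carrier_iff:
  "z \<in> carrier (radic r) \<longleftrightarrow> (\<forall>n. 0 \<le> z n \<and> z n < int r ^ n \<and> z (Suc n) mod int r ^ n = z n)"
  by (simp add: radic_def)

lemma radic_mod: "z \<in> carrier (radic r) \<Longrightarrow> z n mod int r ^ n = z n"
  by (simp add: radic_carrier_iff)

lemma radic_mod_add: "z \<in> carrier (radic r) \<Longrightarrow> z (n + d) mod int r ^ n = z n"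
proof (induction d)
  case 0
  then show ?case by (simp add: radic_mod)
next
  case (Suc d)
  have "z (n + Suc d) mod int r ^ n = z (Suc (n + d)) mod int r ^ (n + d) mod int r ^ n"
    by (simp add: mod_mod_cancel power_add)
  also have "\<dots> = z (n + d) mod int r ^ n" using Suc.prems by (simp add: radic_carrier_iff)
  finally show ?case using Suc by simp
qed

text \<open>Splitting off gcd(n, r) repeatedly moves all primes shared with r into a.\<close>

lemma factor_coprime_part:
  fixes n r :: nat
  assumes "n > 0"
  shows "\<exists>a b s. n = a * b \<and> a dvd r ^ s \<and> coprime b r"
  using assms
proof (induction n rule: less_induct)
  case (less n)
  show ?case
  proof (cases "coprime n r")
    case True
    then show ?thesis by (intro exI[of _ 1] exI[of _ n] exI[of _ 0]) auto
  next
    case False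
    define g where "g = gcd n r"
    obtain n' where n': "n = g * n'" unfolding g_def by (meson dvdE gcd_dvd1)
    have "g > 0" "g \<noteq> 1" using less.prems False by (simp_all add: g_def coprime_iff_gcd_eq_1)
    then have "n' > 0" "n' < n" using less.prems n' by (auto intro!: Nat.gr0I)
    then obtain a b s where ab: "n' = a * b" "a dvd r ^ s" "coprime b r" using less.IH by blast
    have "g dvd r" by (simp add: g_def)
    then have "g * a dvd r ^ Suc s" using ab(2) by (simp add: mult_dvd_mono)
    moreover have "n = (g * a) * b" using n' ab(1) by (simp add: mult.assoc)
    ultimately show ?thesis using ab(3) by blast
  qed
qed

text \<open>r may be composite. With n = ab, the factor b is invertible modulo every power of r, and
  a divides r^s, so multiplication by a costs at most s digits: vanishing at level i + s gives z i =
  0.\<close>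

lemma radic_torsion_free:
  assumes z: "z \<in> carrier (radic r)" and r: "r > 0" and n: "n > 0"
    and nz: "\<And>i. (int n * z i) mod int r ^ i = 0"
  shows "z i = 0"
proof -
  obtain a b s where ab: "n = a * b" "a dvd r ^ s" "coprime b r" using factor_coprime_part[OF n] by blast
  obtain a' where a': "r ^ s = a * a'" using ab(2) by (elim dvdE)
  then have a0: "a > 0" using r by (metis mult_is_0 neq0_conv power_not_zero)
  have "int r ^ (i + s) dvd int b * (int a * z (i + s))"
    using nz[of "i + s"] ab(1) by (simp add: mod_eq_0_iff_dvd mult_ac)
  moreover have "coprime (int r ^ (i + s)) (int b)" using ab(3) by (simp add: coprime_commute)
  ultimately have "int r ^ (i + s) dvd int a * z (i + s)" by (simp add: coprime_dvd_mult_right_iff)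
  moreover have "int r ^ (i + s) = int a * (int r ^ i * int a')"
    using a' by (metis (no_types, lifting) mult.left_commute of_nat_mult of_nat_power power_add)
  ultimately have "int r ^ i * int a' dvd z (i + s)" using a0 by simp
  then have "int r ^ i dvd z (i + s)" by (rule dvd_mult_left)
  then show ?thesis using radic_mod_add[OF z, of i s] by (simp add: mod_eq_0_iff_dvd)
qed

lemma radic_add_pow_one: "([k] \<cdot>\<^bsub>radic r\<^esub> \<one>\<^bsub>radic r\<^esub>) n = int k mod int r ^ n"
proof -
  have "(\<one>\<^bsub>radic r\<^esub> [^]\<^bsub>add_monoid (radic r)\<^esub> k) n = int k mod int r ^ n"
    by (induction k) (simp_all add: nat_pow_def radic_def mod_simps ac_simps)
  then show ?thesis by (simp add: add_pow_def)
qed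

text \<open>The inverse is a definite description, so uniqueness is due: y = y(kz) = z(ky) = z,
  computed modulo each r^n.\<close>

lemma radic_recip_eqI:
  assumes z: "z \<in> carrier (radic r)" and kz: "\<And>n. (int k * z n) mod int r ^ n = 1 mod int r ^ n"
  shows "radic_recip r k = z"
  unfolding radic_recip_def m_inv_def
proof (rule the_equality)
  let ?k = "[k] \<cdot>\<^bsub>radic r\<^esub> \<one>\<^bsub>radic r\<^esub>"
  have mult: "(?k \<otimes>\<^bsub>radic r\<^esub> y) n = (int k * y n) mod int r ^ n"
    "(y \<otimes>\<^bsub>radic r\<^esub> ?k) n = (int k * y n) mod int r ^ n" for y n
    using radic_add_pow_one[of r k n] by (simp_all add: radic_def mod_simps mult.commute)
  have one: "\<one>\<^bsub>radic r\<^esub> n = 1 mod int r ^ n" for n by (simp add: radic_def)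
  show "z \<in> carrier (radic r) \<and> ?k \<otimes>\<^bsub>radic r\<^esub> z = \<one>\<^bsub>radic r\<^esub> \<and> z \<otimes>\<^bsub>radic r\<^esub> ?k = \<one>\<^bsub>radic r\<^esub>"
    using z kz mult one by (auto simp: fun_eq_iff)
  fix y assume y: "y \<in> carrier (radic r) \<and> ?k \<otimes>\<^bsub>radic r\<^esub> y = \<one>\<^bsub>radic r\<^esub> \<and> y \<otimes>\<^bsub>radic r\<^esub> ?k = \<one>\<^bsub>radic r\<^esub>"
  show "y = z"
  proof
    fix n
    have ky: "(int k * y n) mod int r ^ n = 1 mod int r ^ n" using y mult(1)[of y n] one by simp
    have "y n = (y n * ((int k * z n) mod int r ^ n)) mod int r ^ n"
      unfolding kz using y by (simp add: mod_simps radic_mod)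
    also have "\<dots> = (z n * ((int k * y n) mod int r ^ n)) mod int r ^ n"
      by (simp add: mod_simps mult_ac)
    also have "\<dots> = z n" unfolding ky using z by (simp add: mod_simps radic_mod)
    finally show "y n = z n" .
  qed
qed

lemma radic_recip_mult:
  assumes k: "coprime k r" and r: "r > 0"
  shows "(int k * radic_recip r k n) mod int r ^ n = 1 mod int r ^ n"
proof -
  have "\<exists>u. (int k * u) mod int r ^ n = 1 mod int r ^ n" for n
  proof -
    have "coprime (int k) (int r ^ n)" using k by simp
    then obtain u v where "u * int k + v * int r ^ n = 1"
      using bezout_int[of "int k" "int r ^ n"] by auto
    then have "int k * u = 1 + (- v) * int r ^ n" by (simp add: algebra_simps)
    then have "(int k * u) mod int r ^ n = 1 mod int r ^ n" by (simp only: mod_mult_self1)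
    then show ?thesis by blast
  qed
  then obtain u where u: "\<And>n. (int k * u n) mod int r ^ n = 1 mod int r ^ n" by metis
  define z where "z n = u n mod int r ^ n" for n
  have kz: "(int k * z n) mod int r ^ n = 1 mod int r ^ n" for n
    using u[of n] by (simp add: z_def mod_simps)
  have "z \<in> carrier (radic r)"
    unfolding radic_carrier_iff
  proof (intro allI conjI)
    fix n
    show "0 \<le> z n" "z n < int r ^ n" using r by (auto simp: z_def)
    have "(int k * z (Suc n)) mod int r ^ Suc n mod int r ^ n = 1 mod int r ^ Suc n mod int r ^ n"
      by (simp only: kz)
    then have kz': "(int k * z (Suc n)) mod int r ^ n = 1 mod int r ^ n"
      by (simp add: mod_mod_cancel)
    \<comment> \<open>Both \<open>z (Suc n)\<close> and \<open>z n\<close> invert k modulo r^n, and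
      such inverses coincide; this makes independently chosen levels compatible.\<close>
    have "z (Suc n) mod int r ^ n = (z (Suc n) * ((int k * z n) mod int r ^ n)) mod int r ^ n"
      unfolding kz by (simp add: mod_simps)
    also have "\<dots> = (z n * ((int k * z (Suc n)) mod int r ^ n)) mod int r ^ n"
      by (simp add: mod_simps mult_ac)
    also have "\<dots> = z n mod int r ^ n" unfolding kz' by (simp add: mod_simps)
    finally show "z (Suc n) mod int r ^ n = z n" by (simp add: z_def)
  qed
  then show ?thesis using radic_recip_eqI kz by metis
qed

section \<open>Recognizability and asymptotic pairs through the odometer factor\<close>

locale odometer_factor = aperiodic_substitution r \<theta> for r and \<theta> :: "'a::finite \<Rightarrow> 'a list" +
  fixes \<pi> :: "(int \<Rightarrow> 'a) \<Rightarrow> (nat \<Rightarrow> int)"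
  assumes factor: "factor_map (X_top r \<theta>) shift (radic_top r) (radic_succ r) \<pi>"
begin

lemma \<pi>_carrier: "x \<in> X \<Longrightarrow> \<pi> x \<in> carrier (radic r)"
  using factor by (auto simp: factor_map_def radic_top_def)

lemma \<pi>_mod: "x \<in> X \<Longrightarrow> \<pi> x n mod int r ^ n = \<pi> x n"
  using \<pi>_carrier radic_mod by blast

lemma \<pi>_shift: "x \<in> X \<Longrightarrow> \<pi> (shift x) n = (\<pi> x n + 1) mod int r ^ n"
proof -
  assume "x \<in> X"
  then have "\<pi> (shift x) = radic_succ r (\<pi> x)" using factor by (simp add: factor_map_def)
  then show ?thesis by (simp add: radic_succ_def radic_def mod_simps)
qed

lemma \<pi>_sh_nat: "x \<in> X \<Longrightarrow> \<pi> (sh (int c) x) n = (\<pi> x n + int c) mod int r ^ n"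
proof (induction c)
  case 0
  then show ?case by (simp add: \<pi>_mod)
next
  case (Suc c)
  then show ?case using \<pi>_shift[of "sh (int c) x" n] by (simp add: shift_eq_sh mod_simps ac_simps)
qed

lemma \<pi>_sh: assumes "x \<in> X" shows "\<pi> (sh c x) n = (\<pi> x n + c) mod int r ^ n"
proof (cases "c \<ge> 0")
  case True
  then show ?thesis using \<pi>_sh_nat[OF assms, of "nat c" n] by simp
next
  case False
  then have "\<pi> x n = (\<pi> (sh c x) n - c) mod int r ^ n"
    using \<pi>_sh_nat[of "sh c x" "nat (- c)" n] assms by simp
  then have "(\<pi> x n + c) mod int r ^ n = \<pi> (sh c x) n mod int r ^ n" by (simp add: mod_simps)
  then show ?thesis using assms by (simp add: \<pi>_mod)
qed

lemma \<pi>_continuous: "continuous_map (X_top r \<theta>) (discrete_topology UNIV) (\<lambda>x. \<pi> x n)"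
proof -
  have "continuous_map (X_top r \<theta>) (radic_top r) \<pi>" using factor by (simp add: factor_map_def)
  then have "continuous_map (X_top r \<theta>) (product_topology (\<lambda>_. discrete_topology UNIV) UNIV) \<pi>"
    by (simp add: radic_top_def continuous_map_in_subtopology)
  then show ?thesis by (simp add: continuous_map_componentwise_UNIV)
qed

lemma \<pi>_locally_constant: "locally_constant (\<lambda>x. \<pi> x n)"
  by (rule continuous_imp_locally_constant[OF \<pi>_continuous])

lemma locally_constant_sub:
  assumes "locally_constant f" shows "locally_constant (\<lambda>y. f (sub n y))"
  unfolding locally_constant_def
proof
  fix x assume x: "x \<in> X"
  obtain N where N: "\<forall>z\<in>X. agree N z (sub n x) \<longrightarrow> f z = f (sub n x)"
    using bspec[OF assms[unfolded locally_constant_def] sub_in_X[OF x, of n]] by blast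
  \<comment> \<open>A crude bound: the sum exceeds each single index of a block meeting
    [-N, N].\<close>
  define M where "M = nat (\<Sum>i\<in>{- int N..int N}. \<bar>i div int (r ^ n)\<bar>)"
  have "f (sub n y) = f (sub n x)" if y: "y \<in> X" "agree M y x" for y
  proof -
    have "agree N (sub n y) (sub n x)" unfolding agree_def
    proof (intro allI impI)
      fix i assume "\<bar>i\<bar> \<le> int N"
      then have "\<bar>i div int (r ^ n)\<bar> \<le> (\<Sum>i\<in>{- int N..int N}. \<bar>i div int (r ^ n)\<bar>)"
        by (intro member_le_sum[of i "{- int N..int N}" "\<lambda>i. \<bar>i div int (r ^ n)\<bar>"]) auto
      then have "\<bar>i div int (r ^ n)\<bar> \<le> int M" unfolding M_def by linarith
      then have "y (i div int (r ^ n)) = x (i div int (r ^ n))" using y(2) unfolding agree_def by blast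
      then show "sub n y i = sub n x i" unfolding sub_def by (rule arg_cong)
    qed
    then show ?thesis using N sub_in_X[OF y(1)] by blast
  qed
  then show "\<exists>M. \<forall>y\<in>X. agree M y x \<longrightarrow> f (sub n y) = f (sub n x)" by blast
qed

text \<open>Recognizability: the factor map determines how a point is cut into blocks, because
  \<open>\<pi>\<close> modulo \<open>r\<^sup>n\<close> is invariant under the shift of \<open>y\<close> on the points \<open>\<theta>\<^sup>n(y)\<close>.\<close>

lemma \<pi>_sub_constant:
  assumes "y \<in> X" "y' \<in> X" shows "\<pi> (sub n y) n = \<pi> (sub n y') n"
proof (rule invariant_constant[OF locally_constant_sub[OF \<pi>_locally_constant] _ assms])
  fix x assume x: "x \<in> X"
  have "sub n (shift x) = sh (int (r ^ n)) (sub n x)" by (simp add: shift_eq_sh sub_sh)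
  then show "\<pi> (sub n (shift x)) n = \<pi> (sub n x) n"
    using \<pi>_sh[OF sub_in_X[OF x], of "int (r ^ n)" n n] \<pi>_mod[OF sub_in_X[OF x]] by simp
qed

text \<open>Modulo r^n the value of \<pi> is a common constant C plus the offset, so equal values
  force equal offsets below r^n.\<close>

lemma desubstitute_pair:
  assumes x: "x \<in> X" and x': "x' \<in> X" and eq: "\<pi> x n = \<pi> x' n"
  shows "\<exists>m y y'. m < r ^ n \<and> y \<in> X \<and> y' \<in> X \<and> x = sh (int m) (sub n y) \<and> x' = sh (int m) (sub n y')"
proof -
  obtain m y where m: "m < r ^ n" "y \<in> X" "x = sh (int m) (sub n y)" using desubstitute[OF x] by blast
  obtain m' y' where m': "m' < r ^ n" "y' \<in> X" "x' = sh (int m') (sub n y')" using desubstitute[OF x'] by blast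
  define C where "C = \<pi> (sub n y) n"
  have "(C + int m) mod int r ^ n = (C + int m') mod int r ^ n"
    using eq m m' \<pi>_sh[OF sub_in_X] \<pi>_sub_constant[OF m(2) m'(2)] by (simp add: C_def)
  then have "(C + int m - C) mod int r ^ n = (C + int m' - C) mod int r ^ n" by (metis mod_diff_left_eq)
  then have "int m mod int (r ^ n) = int m' mod int (r ^ n)" by simp
  then have "m = m'" using m(1) m'(1) by simp
  then show ?thesis using m m' by blast
qed

text \<open>\<pi> modulo r^n sees only a window of some radius N. After a shift by N that window
  lies where the two points agree, and the shift changes both values equally.\<close>

lemma asymptotic_\<pi>_eq:
  assumes "(x, y) \<in> asymptotic_pairs" shows "\<pi> x n = \<pi> y n"
proof -
  have xy: "x \<in> X" "y \<in> X" "\<forall>i\<ge>0. x i = y i" using assms by (auto simp: asymptotic_pairs_def)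
  obtain N where N: "\<forall>x\<in>X. \<forall>y\<in>X. agree N x y \<longrightarrow> \<pi> x n = \<pi> y n"
    using locally_constant_uniform[OF \<pi>_locally_constant] by blast
  have "agree N (sh (int N) x) (sh (int N) y)" using xy(3) by (auto simp: agree_def sh_apply)
  then have "\<pi> (sh (int N) x) n = \<pi> (sh (int N) y) n" using N xy by simp
  then have "(\<pi> x n + int N) mod int r ^ n = (\<pi> y n + int N) mod int r ^ n" using xy by (simp add: \<pi>_sh)
  then have "(\<pi> x n + int N - int N) mod int r ^ n = (\<pi> y n + int N - int N) mod int r ^ n"
    by (metis mod_diff_left_eq)
  then show ?thesis using xy by (simp add: \<pi>_mod)
qed

lemma sub_block: "0 \<le> i \<Longrightarrow> i < int (r ^ n) \<Longrightarrow> sub n y i = col n (nat i) (y 0)"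
  by (simp add: sub_def)

text \<open>Desubstituting an asymptotic pair \<open>n\<close> times, the cutting point \<open>m\<close> is one more than the last
  position at which the blocks of the two central letters differ. Hence boundedly many letters
  determine \<open>x\<close> on a window of length about \<open>r\<^sup>n\<close>, with a bound independent of \<open>n\<close>.\<close>

lemma finite_asymptotic: "finite (fst ` asymptotic_pairs)"
proof (rule finite_if_finitely_coded)
  show "finite (UNIV :: ('a \<times> 'a \<times> 'a \<times> 'a) set)" by simp
  fix N
  obtain n where n: "N < r ^ n" using power_r_unbounded by blast
  define D where "D x c m y y' \<longleftrightarrow> c = (y (-1), y 0, y 1, y' 0) \<and> m < r ^ n \<and> x = sh (int m) (sub n y) \<and>
      (sh (int m) (sub n y), sh (int m) (sub n y')) \<in> asymptotic_pairs"
    for x c m and y y' :: "int \<Rightarrow> 'a"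
  have "\<exists>c m y y'. D x c m y y'" if x: "x \<in> fst ` asymptotic_pairs" for x
  proof -
    obtain x' where x': "(x, x') \<in> asymptotic_pairs" using x by auto
    then have "x \<in> X" "x' \<in> X" by (auto simp: asymptotic_pairs_def)
    then obtain m y y' where "m < r ^ n" "x = sh (int m) (sub n y)" "x' = sh (int m) (sub n y')"
      using desubstitute_pair asymptotic_\<pi>_eq[OF x'] by blast
    then show ?thesis unfolding D_def using x' by blast
  qed
  then obtain g where g: "\<And>x. x \<in> fst ` asymptotic_pairs \<Longrightarrow> \<exists>m y y'. D x (g x) m y y'" by metis
  have cut_le: "m2 \<le> m1" if D1: "D x1 c m1 y1 y1'" and D2: "D x2 c m2 y2 y2'" for x1 x2 c m1 m2 y1 y1' y2 y2'
  proof (rule ccontr)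
    assume "\<not> m2 \<le> m1"
    then have less: "m1 < m2" by simp
    define i where "i = int m2 - 1"
    have "int m2 < int (r ^ n)" using D2 unfolding D_def of_nat_less_iff by blast
    then have i: "0 \<le> i" "i < int (r ^ n)" "int m1 \<le> i" using less unfolding i_def by linarith+
    have "sub n y2 i \<noteq> sub n y2' i"
      using D2 by (auto simp: D_def asymptotic_pairs_def sh_apply i_def)
    moreover have "\<forall>j\<ge>0. sub n y1 (j + int m1) = sub n y1' (j + int m1)"
      using D1 by (simp add: D_def asymptotic_pairs_def sh_apply)
    then have "sub n y1 i = sub n y1' i" using i(3) by (metis diff_add_cancel diff_ge_0_iff_ge)
    ultimately show False
      using D1 D2 i(1,2) by (auto simp: D_def sub_block)
  qed
  have "agree N x1 x2" if x12: "x1 \<in> fst ` asymptotic_pairs" "x2 \<in> fst ` asymptotic_pairs" "g x1 = g x2" for x1 x2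
  proof -
    obtain m1 y1 y1' where D1: "D x1 (g x1) m1 y1 y1'" using g x12(1) by blast
    obtain m2 y2 y2' where D2: "D x2 (g x1) m2 y2 y2'" using g[OF x12(2)] unfolding x12(3) by blast
    have "m1 = m2" using cut_le[OF D1 D2] cut_le[OF D2 D1] by simp
    then have "agree (r ^ n - 1) x1 x2"
      using D1 D2 sub_window[of y1 y2 m1 n] by (auto simp: D_def)
    then show ?thesis by (rule agree_mono) (use n in simp)
  qed
  then show "\<exists>g. g ` fst ` asymptotic_pairs \<subseteq> (UNIV :: ('a \<times> 'a \<times> 'a \<times> 'a) set) \<and>
      (\<forall>x\<in>fst ` asymptotic_pairs. \<forall>y\<in>fst ` asymptotic_pairs. g x = g y \<longrightarrow> agree N x y)"
    by (intro exI[of _ g]) auto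
qed

text \<open>By uniform continuity \<Phi> reads a bounded window, so the images still agree far to
  the right; injectivity keeps them distinct, so a last disagreement exists.\<close>

lemma Aut_asymptotic:
  assumes \<Phi>: "\<Phi> \<in> carrier G" and ab: "(a, b) \<in> asymptotic_pairs"
  shows "\<exists>c. sh c (\<Phi> a) \<in> fst ` asymptotic_pairs"
proof -
  have X: "a \<in> X" "b \<in> X" "\<forall>i\<ge>0. a i = b i" "a \<noteq> b" using ab by (auto simp: asymptotic_pairs_def)
  obtain N where N: "\<forall>x\<in>X. \<forall>y\<in>X. agree N x y \<longrightarrow> \<Phi> x 0 = \<Phi> y 0"
    using locally_constant_uniform[OF Aut_coordinate[OF \<Phi>]] by blast
  have eq: "\<Phi> a i = \<Phi> b i" if "i \<ge> int N" for i
  proof -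
    have "agree N (sh i a) (sh i b)" using X(3) that by (auto simp: agree_def sh_apply)
    then have "\<Phi> (sh i a) 0 = \<Phi> (sh i b) 0" using N X by simp
    then show ?thesis using X \<Phi> by (simp add: Aut_sh sh_apply)
  qed
  have "inj_on \<Phi> X" using \<Phi> by (auto simp: Aut_carrier_iff homeomorphic_map_def)
  then have "\<Phi> a \<noteq> \<Phi> b" using X by (auto simp: inj_on_def)
  then obtain e where e: "\<Phi> a e \<noteq> \<Phi> b e" by blast
  then have "e < int N" using eq by (meson not_le)
  then have ex: "\<Phi> a (int N - int (nat (int N - e))) \<noteq> \<Phi> b (int N - int (nat (int N - e)))" using e by simp
  \<comment> \<open>m counts leftwards from N, so the least value marks the last disagreement N - m;
    a shift by N - m + 1 puts it at -1.\<close>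
  define m where "m = (LEAST m. \<Phi> a (int N - int m) \<noteq> \<Phi> b (int N - int m))"
  have m: "\<Phi> a (int N - int m) \<noteq> \<Phi> b (int N - int m)" unfolding m_def by (rule LeastI, rule ex)
  have after: "\<Phi> a i = \<Phi> b i" if "i > int N - int m" for i
  proof (cases "i \<ge> int N")
    case False
    then have "nat (int N - i) < m" "int N - int (nat (int N - i)) = i" using that by auto
    then show ?thesis using not_less_Least[of "nat (int N - i)" "\<lambda>m. \<Phi> a (int N - int m) \<noteq> \<Phi> b (int N - int m)"]
      unfolding m_def[symmetric] by simp
  qed (use eq in simp)
  have "(sh (int N - int m + 1) (\<Phi> a), sh (int N - int m + 1) (\<Phi> b)) \<in> asymptotic_pairs"
    using m after Aut_X[OF \<Phi>] X by (auto simp: asymptotic_pairs_def sh_apply)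
  then show ?thesis by force
qed

section \<open>The displacement homomorphism \<kappa>\<close>

abbreviation "\<kappa> \<equiv> kappa r \<theta> \<pi>"

text \<open>The displacement \<pi>(\<Phi> x) - \<pi>(x) modulo r^n is locally constant and
  shift-invariant, hence independent of x, and one base point defines z.\<close>

lemma kappa_exists:
  assumes \<Phi>: "\<Phi> \<in> carrier G"
  shows "\<exists>z\<in>carrier (radic r). \<forall>x\<in>X. \<forall>n. \<pi> (\<Phi> x) n = (z n + \<pi> x n) mod int r ^ n"
proof -
  obtain x0 where x0: "x0 \<in> X" using X_nonempty by blast
  define z where "z n = (\<pi> (\<Phi> x0) n - \<pi> x0 n) mod int r ^ n" for n
  have z: "(\<pi> (\<Phi> x) n - \<pi> x n) mod int r ^ n = z n" if x: "x \<in> X" for x n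
    unfolding z_def
  proof (rule invariant_constant[OF _ _ x x0])
    have "continuous_map (X_top r \<theta>) (X_top r \<theta>) \<Phi>"
      using \<Phi> homeomorphic_imp_continuous_map by (auto simp: Aut_carrier_iff)
    from continuous_map_compose[OF this \<pi>_continuous]
    have lc: "locally_constant (\<lambda>x. \<pi> (\<Phi> x) n)"
      by (intro continuous_imp_locally_constant) (simp add: o_def)
    show "locally_constant (\<lambda>x. (\<pi> (\<Phi> x) n - \<pi> x n) mod int r ^ n)"
      unfolding locally_constant_def
    proof
      fix x assume x: "x \<in> X"
      obtain N where N: "\<forall>y\<in>X. agree N y x \<longrightarrow> \<pi> (\<Phi> y) n = \<pi> (\<Phi> x) n"
        using lc x by (auto simp: locally_constant_def)
      obtain M where M: "\<forall>y\<in>X. agree M y x \<longrightarrow> \<pi> y n = \<pi> x n"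
        using \<pi>_locally_constant[of n] x by (auto simp: locally_constant_def)
      have "(\<pi> (\<Phi> y) n - \<pi> y n) mod int r ^ n = (\<pi> (\<Phi> x) n - \<pi> x n) mod int r ^ n"
        if "y \<in> X" "agree (max N M) y x" for y
        using that N M agree_mono[OF that(2), of N] agree_mono[OF that(2), of M] by simp
      then show "\<exists>N. \<forall>y\<in>X. agree N y x \<longrightarrow>
          (\<pi> (\<Phi> y) n - \<pi> y n) mod int r ^ n = (\<pi> (\<Phi> x) n - \<pi> x n) mod int r ^ n" by blast
    qed
    fix x assume x: "x \<in> X"
    then have "\<Phi> (shift x) = shift (\<Phi> x)" using Aut_sh[OF \<Phi>] by (simp add: shift_eq_sh)
    then show "(\<pi> (\<Phi> (shift x)) n - \<pi> (shift x) n) mod int r ^ n = (\<pi> (\<Phi> x) n - \<pi> x n) mod int r ^ n"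
      using \<pi>_shift[OF x] \<pi>_shift[OF Aut_X[OF \<Phi> x]] by (simp add: mod_simps)
  qed
  have "z \<in> carrier (radic r)"
    unfolding radic_carrier_iff
  proof (intro allI conjI)
    fix n
    show "0 \<le> z n" "z n < int r ^ n" using r_pos by (auto simp: z_def)
    have "z (Suc n) mod int r ^ n = (\<pi> (\<Phi> x0) (Suc n) - \<pi> x0 (Suc n)) mod int r ^ n"
      by (simp add: z_def mod_mod_cancel)
    also have "\<dots> = (\<pi> (\<Phi> x0) (Suc n) mod int r ^ n - \<pi> x0 (Suc n) mod int r ^ n) mod int r ^ n"
      by (simp add: mod_simps)
    also have "\<dots> = z n"
      using \<pi>_carrier[OF x0] \<pi>_carrier[OF Aut_X[OF \<Phi> x0]] by (simp add: z_def radic_carrier_iff)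
    finally show "z (Suc n) mod int r ^ n = z n" .
  qed
  moreover have "\<pi> (\<Phi> x) n = (z n + \<pi> x n) mod int r ^ n" if x: "x \<in> X" for x n
    using \<pi>_mod[OF Aut_X[OF \<Phi> x], of n] by (simp add: mod_simps flip: z[OF x])
  ultimately show ?thesis by blast
qed

lemma kappa_unique:
  assumes "x \<in> X" "z \<in> carrier (radic r)" "z' \<in> carrier (radic r)"
    and "\<And>n. (z n + \<pi> x n) mod int r ^ n = (z' n + \<pi> x n) mod int r ^ n"
  shows "z = z'"
proof
  fix n
  have "(z n + \<pi> x n - \<pi> x n) mod int r ^ n = (z' n + \<pi> x n - \<pi> x n) mod int r ^ n"
    using assms(4) by (metis mod_diff_left_eq)
  then show "z n = z' n" using assms(2,3) by (simp add: radic_mod)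
qed

text \<open>\<open>kappa\<close> is a definite description over all of X; since the displacement is
  constant, testing a single point is enough.\<close>

lemma kappa_eqI:
  assumes \<Phi>: "\<Phi> \<in> carrier G" and x: "x \<in> X" and z: "z \<in> carrier (radic r)"
    and eq: "\<And>n. \<pi> (\<Phi> x) n = (z n + \<pi> x n) mod int r ^ n"
  shows "\<kappa> \<Phi> = z"
proof -
  obtain w where w: "w \<in> carrier (radic r)" "\<forall>x\<in>X. \<forall>n. \<pi> (\<Phi> x) n = (w n + \<pi> x n) mod int r ^ n"
    using kappa_exists[OF \<Phi>] by blast
  have "z = w" using kappa_unique[OF x z w(1)] eq w(2) x by metis
  have add: "(\<pi> (\<Phi> y) = v \<oplus>\<^bsub>radic r\<^esub> \<pi> y) \<longleftrightarrow> (\<forall>n. \<pi> (\<Phi> y) n = (v n + \<pi> y n) mod int r ^ n)" for v y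
    by (simp add: radic_def fun_eq_iff)
  show ?thesis
    unfolding kappa_def add \<open>z = w\<close>
  proof (rule the_equality)
    show "w \<in> carrier (radic r) \<and> (\<forall>x\<in>X. \<forall>n. \<pi> (\<Phi> x) n = (w n + \<pi> x n) mod int r ^ n)" using w by blast
  next
    fix v assume v: "v \<in> carrier (radic r) \<and> (\<forall>x\<in>X. \<forall>n. \<pi> (\<Phi> x) n = (v n + \<pi> x n) mod int r ^ n)"
    show "v = w" using kappa_unique[OF x _ w(1), of v] v w(2) x by metis
  qed
qed

lemma
  assumes \<Phi>: "\<Phi> \<in> carrier G"
  shows kappa_carrier: "\<kappa> \<Phi> \<in> carrier (radic r)"
    and kappa_apply: "x \<in> X \<Longrightarrow> \<pi> (\<Phi> x) n = (\<kappa> \<Phi> n + \<pi> x n) mod int r ^ n"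
proof -
  obtain w where w: "w \<in> carrier (radic r)" "\<forall>x\<in>X. \<forall>n. \<pi> (\<Phi> x) n = (w n + \<pi> x n) mod int r ^ n"
    using kappa_exists[OF \<Phi>] by blast
  obtain x0 where "x0 \<in> X" using X_nonempty by blast
  then have "\<kappa> \<Phi> = w" using kappa_eqI[OF \<Phi> _ w(1)] w(2) by blast
  then show "\<kappa> \<Phi> \<in> carrier (radic r)" "x \<in> X \<Longrightarrow> \<pi> (\<Phi> x) n = (\<kappa> \<Phi> n + \<pi> x n) mod int r ^ n"
    using w by auto
qed

lemma kappa_mult:
  assumes "\<Phi> \<in> carrier G" "\<Psi> \<in> carrier G"
  shows "\<kappa> (\<Phi> \<otimes>\<^bsub>G\<^esub> \<Psi>) n = (\<kappa> \<Phi> n + \<kappa> \<Psi> n) mod int r ^ n"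
proof -
  obtain x where x: "x \<in> X" using X_nonempty by blast
  let ?z = "\<lambda>n. (\<kappa> \<Phi> n + \<kappa> \<Psi> n) mod int r ^ n"
  have "?z \<in> carrier (radic r)"
    unfolding radic_carrier_iff
  proof (intro allI conjI)
    fix n
    show "0 \<le> ?z n" "?z n < int r ^ n" using r_pos by auto
    have "?z (Suc n) mod int r ^ n = (\<kappa> \<Phi> (Suc n) mod int r ^ n + \<kappa> \<Psi> (Suc n) mod int r ^ n) mod int r ^ n"
      by (simp add: mod_mod_cancel mod_simps)
    then show "?z (Suc n) mod int r ^ n = ?z n"
      using kappa_carrier[OF assms(1)] kappa_carrier[OF assms(2)] by (simp add: radic_carrier_iff)
  qed
  moreover have "\<pi> ((\<Phi> \<otimes>\<^bsub>G\<^esub> \<Psi>) x) n = (?z n + \<pi> x n) mod int r ^ n" for n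
    using assms x by (simp add: Aut_mult_apply kappa_apply Aut_X mod_simps ac_simps)
  ultimately have "\<kappa> (\<Phi> \<otimes>\<^bsub>G\<^esub> \<Psi>) = ?z" using assms x by (intro kappa_eqI) auto
  then show ?thesis by simp
qed

lemma radic_of_int: "(\<lambda>n. c mod int r ^ n) \<in> carrier (radic r)"
  using r_pos by (auto simp: radic_carrier_iff mod_mod_cancel)

lemma kappa_\<sigma>_pow: "\<kappa> (\<sigma> [^]\<^bsub>G\<^esub> (c::int)) n = c mod int r ^ n"
proof -
  obtain x where x: "x \<in> X" using X_nonempty by blast
  have "\<kappa> (\<sigma> [^]\<^bsub>G\<^esub> c) = (\<lambda>n. c mod int r ^ n)"
    unfolding \<sigma>_int_pow using x \<pi>_sh[OF x]
    by (intro kappa_eqI[OF restrict_sh_Aut x radic_of_int]) (simp add: mod_simps add.commute)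
  then show ?thesis by simp
qed

lemma kappa_one: "\<kappa> \<one>\<^bsub>G\<^esub> n = 0"
  using kappa_\<sigma>_pow[of 0 n] by simp

lemma kappa_\<sigma>: "\<kappa> \<sigma> n = 1 mod int r ^ n"
  using kappa_\<sigma>_pow[of 1 n] Aut.int_pow_1[OF \<sigma>_Aut] by simp

lemma kappa_pow:
  assumes "\<Phi> \<in> carrier G" shows "\<kappa> (\<Phi> [^]\<^bsub>G\<^esub> (m::nat)) n = (int m * \<kappa> \<Phi> n) mod int r ^ n"
proof (induction m)
  case 0
  then show ?case by (simp add: kappa_one)
next
  case (Suc m)
  then show ?case using assms by (simp add: kappa_mult mod_simps algebra_simps)
qed

lemma \<sigma>_infinite_order: assumes "\<sigma> [^]\<^bsub>G\<^esub> (c::int) = \<one>\<^bsub>G\<^esub>" shows "c = 0"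
proof -
  obtain n where n: "nat \<bar>c\<bar> < r ^ n" using power_r_unbounded by blast
  have "c mod int r ^ n = 0" using kappa_\<sigma>_pow[of c n] kappa_one[of n] assms by simp
  then have "int r ^ n dvd c" by (simp add: mod_eq_0_iff_dvd)
  then show ?thesis using n zdvd_imp_le[of "int r ^ n" "\<bar>c\<bar>"]
    by (cases "c = 0") (auto simp: nat_less_iff)
qed

text \<open>If the images of x lie in one shift orbit, a power of \<sigma> matches the two
  automorphisms at x, and one point decides.\<close>

lemma coset_determined:
  assumes \<Phi>: "\<Phi> \<in> carrier G" and \<Psi>: "\<Psi> \<in> carrier G" and x: "x \<in> X" and eq: "sh c (\<Phi> x) = sh d (\<Psi> x)"
  shows "\<Phi> = \<sigma> [^]\<^bsub>G\<^esub> (d - c) \<otimes>\<^bsub>G\<^esub> \<Psi>"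
proof (rule Aut_determined_by_point[OF \<Phi> _ x])
  show "\<sigma> [^]\<^bsub>G\<^esub> (d - c) \<otimes>\<^bsub>G\<^esub> \<Psi> \<in> carrier G" using \<sigma>_Aut \<Psi> by simp
  have "\<Phi> x = sh (- c) (sh c (\<Phi> x))" by simp
  also have "\<dots> = sh (d - c) (\<Psi> x)" unfolding eq by simp
  also have "\<dots> = (\<sigma> [^]\<^bsub>G\<^esub> (d - c) \<otimes>\<^bsub>G\<^esub> \<Psi>) x"
    unfolding \<sigma>_int_pow using restrict_sh_Aut \<Psi> x by (simp add: Aut_mult_apply Aut_X)
  finally show "\<Phi> x = (\<sigma> [^]\<^bsub>G\<^esub> (d - c) \<otimes>\<^bsub>G\<^esub> \<Psi>) x" .
qed

section \<open>Structure of the automorphism group for injective \<kappa>\<close>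

context
  assumes inj: "inj_on \<kappa> (carrier G)"
begin

lemma comm_group_Aut: "comm_group G"
proof (rule Aut.group_comm_groupI)
  fix \<Phi> \<Psi> assume "\<Phi> \<in> carrier G" "\<Psi> \<in> carrier G"
  then show "\<Phi> \<otimes>\<^bsub>G\<^esub> \<Psi> = \<Psi> \<otimes>\<^bsub>G\<^esub> \<Phi>"
    by (intro inj_onD[OF inj] ext) (auto simp: kappa_mult add.commute)
qed

lemma Aut_torsion_free:
  assumes \<Phi>: "\<Phi> \<in> carrier G" and n: "n > 0" "\<Phi> [^]\<^bsub>G\<^esub> (n::int) = \<one>\<^bsub>G\<^esub>" shows "\<Phi> = \<one>\<^bsub>G\<^esub>"
proof -
  have pow: "\<Phi> [^]\<^bsub>G\<^esub> nat n = \<one>\<^bsub>G\<^esub>" using n by (metis int_pow_int nat_0_le order_less_imp_le)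
  have "\<kappa> \<Phi> i = 0" for i
  proof (rule radic_torsion_free[OF kappa_carrier[OF \<Phi>] r_pos])
    show "nat n > 0" using n by simp
    show "(int (nat n) * \<kappa> \<Phi> i) mod int r ^ i = 0" for i
      using kappa_pow[OF \<Phi>, of "nat n" i] unfolding pow kappa_one by simp
  qed
  then show ?thesis using \<Phi> by (intro inj_onD[OF inj] ext) (auto simp: kappa_one)
qed

lemma Aut_generator:
  "\<exists>\<Phi>\<in>carrier G. \<exists>k>0. carrier G = range (\<lambda>n::int. \<Phi> [^]\<^bsub>G\<^esub> n) \<and> \<Phi> [^]\<^bsub>G\<^esub> (k::nat) = \<sigma>"
proof -
  interpret cg: comm_group G by (rule comm_group_Aut)
  obtain a b where ab: "(a, b) \<in> asymptotic_pairs" using asymptotic_pairs_nonempty by auto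
  then have a: "a \<in> X" by (simp add: asymptotic_pairs_def)
  \<comment> \<open>The normalising shift c \<Phi> turns the image of a into a label for the coset
    of \<Phi>, taken from a finite set.\<close>
  obtain c where c: "\<And>\<Phi>. \<Phi> \<in> carrier G \<Longrightarrow> sh (c \<Phi>) (\<Phi> a) \<in> fst ` asymptotic_pairs"
    using Aut_asymptotic[OF _ ab] by metis
  show ?thesis
  proof (rule cg.infinite_cyclic_of_finite_index[OF \<sigma>_Aut \<sigma>_infinite_order Aut_torsion_free finite_asymptotic])
    show "(\<lambda>\<Phi>. sh (c \<Phi>) (\<Phi> a)) ` carrier G \<subseteq> fst ` asymptotic_pairs" using c by blast
  next
    fix \<Phi> \<Psi> assume "\<Phi> \<in> carrier G" "\<Psi> \<in> carrier G" "sh (c \<Phi>) (\<Phi> a) = sh (c \<Psi>) (\<Psi> a)"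
    then show "\<exists>i::int. \<Phi> = \<sigma> [^]\<^bsub>G\<^esub> i \<otimes>\<^bsub>G\<^esub> \<Psi>" using coset_determined[OF _ _ a] by blast
  qed
qed

lemma cyclic_Aut: "cyclic_group G"
  using Aut_generator Aut.cyclic_group by blast

lemma reciprocal_generator_exists: "\<exists>\<Phi> k. reciprocal_generator r \<theta> \<pi> \<Phi> k"
proof -
  obtain \<Phi> k where \<Phi>: "\<Phi> \<in> carrier G" "k > 0" "carrier G = range (\<lambda>n::int. \<Phi> [^]\<^bsub>G\<^esub> n)"
    "\<Phi> [^]\<^bsub>G\<^esub> (k::nat) = \<sigma>" using Aut_generator by blast
  have kk: "(int k * \<kappa> \<Phi> n) mod int r ^ n = 1 mod int r ^ n" for n
    using kappa_pow[OF \<Phi>(1), of k n] \<Phi>(4) kappa_\<sigma> by simp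
  have "coprime (int k) (int r)"
  proof (rule coprimeI)
    fix d assume d: "d dvd int k" "d dvd int r"
    \<comment> \<open>Read k \<kappa>(\<Phi>) = 1 at level one: a common divisor of k and r divides
      1.\<close>
    have "d dvd (int k * \<kappa> \<Phi> 1) mod int r" using d by (simp add: dvd_mod)
    moreover have "(int k * \<kappa> \<Phi> 1) mod int r = 1" using kk[of 1] r_ge_2 by simp
    ultimately show "is_unit d" by simp
  qed
  then have "coprime k r" by simp
  moreover have "carrier G = generate G {\<Phi>}"
    using \<Phi>(3) Aut.generate_pow[OF \<Phi>(1)] by auto
  moreover have "\<kappa> \<Phi> = radic_recip r k"
    using radic_recip_eqI[OF kappa_carrier[OF \<Phi>(1)] kk] by simp
  ultimately show ?thesis using \<Phi> by (auto simp: reciprocal_generator_def)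
qed

text \<open>\<Phi> and k are tied only through \<kappa>(\<Phi>) = 1/k. Then \<Phi>^k and \<sigma>
  both have \<kappa>-value 1, and injectivity makes them equal.\<close>

lemma reciprocal_generator_pow:
  assumes "reciprocal_generator r \<theta> \<pi> \<Phi> k"
  shows "\<Phi> [^]\<^bsub>G\<^esub> k = \<sigma>" and "carrier G = range (\<lambda>n::int. \<Phi> [^]\<^bsub>G\<^esub> n)"
proof -
  have \<Phi>: "\<Phi> \<in> carrier G" "carrier G = generate G {\<Phi>}" "coprime k r" "\<kappa> \<Phi> = radic_recip r k"
    using assms by (auto simp: reciprocal_generator_def)
  show "carrier G = range (\<lambda>n::int. \<Phi> [^]\<^bsub>G\<^esub> n)"
    using \<Phi>(2) Aut.generate_pow[OF \<Phi>(1)] by auto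
  show "\<Phi> [^]\<^bsub>G\<^esub> k = \<sigma>"
    using \<Phi> \<sigma>_Aut radic_recip_mult[OF \<Phi>(3) r_pos]
    by (intro inj_onD[OF inj] ext) (auto simp: kappa_pow kappa_\<sigma>)
qed

end

text \<open>A composition of columns of \<theta> is one column of \<theta>^k. The head of the list
  acts last, so it is the lowest base-r digit of t.\<close>

lemma coincidence_column:
  assumes "has_coincidence r \<theta>" shows "\<exists>k t b. t < r ^ k \<and> (\<forall>a. col k t a = b)"
proof -
  obtain js where js: "set js \<subseteq> {..<r}"
    "card (foldr (\<lambda>i f. (\<lambda>a. \<theta> a ! i) \<circ> f) js id ` UNIV) = 1"
    using assms by (auto simp: has_coincidence_def)
  have "\<exists>t<r ^ length js. foldr (\<lambda>i f. (\<lambda>a. \<theta> a ! i) \<circ> f) js id = col (length js) t"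
    using js(1)
  proof (induction js)
    case Nil
    then show ?case by (auto simp: fun_eq_iff)
  next
    case (Cons i js)
    then have "set js \<subseteq> {..<r}" by simp
    from Cons.IH[OF this] obtain t where t: "t < r ^ length js"
      "foldr (\<lambda>i f. (\<lambda>a. \<theta> a ! i) \<circ> f) js id = col (length js) t" by blast
    have i: "i < r" using Cons.prems by simp
    have "t * r + i < Suc t * r" using i by simp
    also have "\<dots> \<le> r ^ length js * r" using t(1) by (intro mult_right_mono) auto
    finally have "t * r + i < r ^ length (i # js)" by (simp add: mult.commute)
    moreover have "foldr (\<lambda>i f. (\<lambda>a. \<theta> a ! i) \<circ> f) (i # js) id = col (length (i # js)) (t * r + i)"
      unfolding foldr_Cons o_apply[of _ "foldr _ js"] t(2) using i by (simp add: fun_eq_iff)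
    ultimately show ?case by blast
  qed
  then obtain t where t: "t < r ^ length js" "card (range (col (length js) t)) = 1" using js(2) by auto
  then obtain b where "range (col (length js) t) = {b}" by (meson card_1_singletonE)
  then show ?thesis using t(1) by blast
qed

text \<open>A coincidence makes the whole block \<open>\<theta>\<^sup>M(b)\<close> appear at the same place in every
  \<open>\<theta>\<^sup>M\<^sup>+\<^sup>k(a)\<close>, so two automorphisms with the same \<open>\<kappa>\<close> agree on arbitrarily long windows.\<close>

lemma inj_on_kappa_if_coincidence:
  assumes "has_coincidence r \<theta>" shows "inj_on \<kappa> (carrier G)"
proof (rule inj_onI)
  fix \<Phi> \<Psi> assume \<Phi>: "\<Phi> \<in> carrier G" and \<Psi>: "\<Psi> \<in> carrier G" and eq: "\<kappa> \<Phi> = \<kappa> \<Psi>"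
  obtain k t b where t: "t < r ^ k" "\<And>a. col k t a = b" using coincidence_column[OF assms] by blast
  obtain x where x: "x \<in> X" using X_nonempty by blast
  have long: "\<exists>u. \<forall>c. u \<le> c \<and> c < u + int (r ^ M) \<longrightarrow> \<Phi> x c = \<Psi> x c" for M
  proof -
    define n where "n = M + k"
    have "\<pi> (\<Phi> x) n = \<pi> (\<Psi> x) n" using kappa_apply[OF \<Phi> x] kappa_apply[OF \<Psi> x] eq by simp
    then obtain m y y' where m: "\<Phi> x = sh (int m) (sub n y)" "\<Psi> x = sh (int m) (sub n y')"
      using desubstitute_pair Aut_X[OF \<Phi> x] Aut_X[OF \<Psi> x] by blast
    have block: "sub n y (int (t * r ^ M) + int s) = col M s b" if s: "s < r ^ M" for s y
    proof -
      have "t * r ^ M + s < Suc t * r ^ M" using s by simp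
      also have "\<dots> \<le> r ^ k * r ^ M" using t(1) by (intro mult_right_mono) auto
      finally have "t * r ^ M + s < r ^ n" by (simp add: n_def power_add mult.commute)
      then have "sub n y (int (t * r ^ M + s)) = col n (t * r ^ M + s) (y 0)"
        using sub_nat[of n y 0 "t * r ^ M + s"] by simp
      also have "\<dots> = col M s (col k t (y 0))"
        using s r_pos by (simp add: n_def column_add column_periodic)
      finally show ?thesis using t(2) by simp
    qed
    have "\<Phi> x c = \<Psi> x c" if c: "int (t * r ^ M) - int m \<le> c" "c < int (t * r ^ M) - int m + int (r ^ M)" for c
    proof -
      define s where "s = nat (c + int m - int (t * r ^ M))"
      have s: "c + int m = int (t * r ^ M) + int s" "s < r ^ M" using c by (auto simp: s_def nat_less_iff)
      show ?thesis unfolding m sh_apply s(1) using block[OF s(2)] by simp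
    qed
    then show ?thesis by blast
  qed
  show "\<Phi> = \<Psi>"
  proof (rule Aut_eqI[OF \<Phi> \<Psi>])
    fix y assume "y \<in> topspace (X_top r \<theta>)"
    then have y: "y \<in> X" by simp
    have "\<Phi> z 0 = \<Psi> z 0" if z: "z \<in> X" for z
    proof -
      obtain N1 where N1: "\<forall>w\<in>X. agree N1 w z \<longrightarrow> \<Phi> w 0 = \<Phi> z 0"
        using Aut_coordinate[OF \<Phi>, of 0] z by (auto simp: locally_constant_def)
      obtain N2 where N2: "\<forall>w\<in>X. agree N2 w z \<longrightarrow> \<Psi> w 0 = \<Psi> z 0"
        using Aut_coordinate[OF \<Psi>, of 0] z by (auto simp: locally_constant_def)
      \<comment> \<open>A run of agreement longer than the return time L contains a place c at which
        x looks like z, and there both automorphisms show their value at z.\<close>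
      obtain L where L: "\<forall>x\<in>X. \<forall>i. \<exists>c. i \<le> c \<and> c \<le> i + int L \<and> agree (max N1 N2) (sh c x) z"
        using agree_returns[OF z] by blast
      obtain M where M: "L < r ^ M" using power_r_unbounded by blast
      obtain u where u: "\<And>c. u \<le> c \<and> c < u + int (r ^ M) \<Longrightarrow> \<Phi> x c = \<Psi> x c" using long by metis
      obtain c where c: "u \<le> c" "c \<le> u + int L" "agree (max N1 N2) (sh c x) z" using L x by metis
      have "int L < int (r ^ M)" using M by (simp only: of_nat_less_iff)
      then have "\<Phi> x c = \<Psi> x c" using u[of c] c by linarith
      then have "\<Phi> (sh c x) 0 = \<Psi> (sh c x) 0" using \<Phi> \<Psi> x by (simp add: Aut_sh sh_apply)
      moreover have "agree N1 (sh c x) z" "agree N2 (sh c x) z" using c(3) agree_mono by fastforce+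
      ultimately show ?thesis using N1 N2 x by simp
    qed
    from this[of "sh _ y"] show "\<Phi> y = \<Psi> y"
      using \<Phi> \<Psi> y by (simp add: Aut_sh sh_apply fun_eq_iff)
  qed
qed

end

section \<open>Towers over the pure base\<close>

lemma level_tower_commute:
  "(\<And>x. x \<in> X \<Longrightarrow> \<Phi> (shift x) = shift (\<Phi> x)) \<Longrightarrow> fst y \<in> X \<Longrightarrow>
    level_map \<Phi> (tower_map h y) = tower_map h (level_map \<Phi> y)"
  by (cases y) (auto simp: level_map_def tower_map_def)

text \<open>An odometer with carry: i + n counts steps from the bottom floor, and each passage over
  the top is one shift of the base.\<close>

lemma tower_map_power:
  "i < h \<Longrightarrow> (tower_map h ^^ n) (x, i) = (sh (int ((i + n) div h)) x, (i + n) mod h)"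
proof (induction n)
  case (Suc n)
  have "(tower_map h ^^ Suc n) (x, i) = tower_map h (sh (int ((i + n) div h)) x, (i + n) mod h)"
    using Suc by simp
  also have "\<dots> = (sh (int (Suc (i + n) div h)) x, Suc (i + n) mod h)"
    using Suc.prems mod_less_divisor[of h "i + n"]
    by (auto simp: tower_map_def shift_eq_sh div_Suc mod_Suc add.commute simp del: mod_less_divisor)
  finally show ?case by simp
qed simp

locale tower = base: odometer_factor r \<theta>' \<pi> + top: aperiodic_substitution r \<theta>
  for r and \<theta>' :: "'b::finite \<Rightarrow> 'b list" and \<pi> and \<theta> :: "'a::finite \<Rightarrow> 'a list" +
  fixes h :: nat and F :: "(int \<Rightarrow> 'a) \<Rightarrow> (int \<Rightarrow> 'b) \<times> nat"
  assumes h: "h > 0"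
    and conj: "conjugacy (X_top r \<theta>) shift (tower_top r \<theta>' h) (tower_map h) F"
begin

definition E :: "(int \<Rightarrow> 'b) \<times> nat \<Rightarrow> (int \<Rightarrow> 'a)" where
  "E = inv_into top.X F"

lemma topspace_tower [simp]: "topspace (tower_top r \<theta>' h) = base.X \<times> {0..<h}"
  by (simp add: tower_top_def)

lemma F_homeomorphic: "homeomorphic_map (X_top r \<theta>) (tower_top r \<theta>' h) F"
  using conj by (simp add: conjugacy_def)

lemma F_bij: "bij_betw F top.X (base.X \<times> {0..<h})"
  using F_homeomorphic by (auto simp: homeomorphic_eq_everything_map bij_betw_def)

lemma F_in: "x \<in> top.X \<Longrightarrow> F x \<in> base.X \<times> {0..<h}"
  using F_bij by (auto simp: bij_betw_def)

lemma fst_F_in: "x \<in> top.X \<Longrightarrow> fst (F x) \<in> base.X"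
  using F_in by (auto simp: mem_Times_iff)

lemma snd_F_less: "x \<in> top.X \<Longrightarrow> snd (F x) < h"
  using F_in by (auto simp: mem_Times_iff)

lemma E_F [simp]: "x \<in> top.X \<Longrightarrow> E (F x) = x"
  using F_bij by (simp add: E_def bij_betw_def)

lemma F_E [simp]: "x \<in> base.X \<Longrightarrow> i < h \<Longrightarrow> F (E (x, i)) = (x, i)"
  using F_bij f_inv_into_f[of "(x, i)" F top.X] by (simp add: E_def bij_betw_def)

lemma E_in [simp]: "x \<in> base.X \<Longrightarrow> i < h \<Longrightarrow> E (x, i) \<in> top.X"
  using F_bij inv_into_into[of "(x, i)" F top.X] by (simp add: E_def bij_betw_def)

lemma F_eqI: "x \<in> top.X \<Longrightarrow> y \<in> top.X \<Longrightarrow> F x = F y \<Longrightarrow> x = y"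
  using E_F by metis

lemma FE_homeomorphic_maps: "homeomorphic_maps (X_top r \<theta>) (tower_top r \<theta>' h) F E"
proof -
  obtain g where g: "homeomorphic_maps (X_top r \<theta>) (tower_top r \<theta>' h) F g"
    using F_homeomorphic by (auto simp: homeomorphic_map_maps)
  show ?thesis
  proof (rule homeomorphic_maps_eq[OF g])
    fix y assume y: "y \<in> topspace (tower_top r \<theta>' h)"
    then have "g y \<in> top.X" "F (g y) = y"
      using g by (auto simp: homeomorphic_maps_def continuous_map_def)
    then show "g y = E y" using E_F by metis
  qed simp
qed

lemma F_continuous: "continuous_map (X_top r \<theta>) (tower_top r \<theta>' h) F"
  and E_continuous: "continuous_map (tower_top r \<theta>' h) (X_top r \<theta>) E"
  using FE_homeomorphic_maps by (auto simp: homeomorphic_maps_def)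

lemma F_shift: "x \<in> top.X \<Longrightarrow> F (shift x) = tower_map h (F x)"
  using conj by (simp add: conjugacy_def)

lemma F_sh:
  assumes "x \<in> top.X"
  shows "F (sh (int n) x) = (sh (int ((snd (F x) + n) div h)) (fst (F x)), (snd (F x) + n) mod h)"
proof -
  have "F (sh (int n) x) = (tower_map h ^^ n) (F x)"
  proof (induction n)
    case (Suc n)
    then show ?case using F_shift[of "sh (int n) x"] assms by (simp add: shift_eq_sh)
  qed simp
  also have "\<dots> = (tower_map h ^^ n) (fst (F x), snd (F x))" by simp
  finally show ?thesis unfolding tower_map_power[OF snd_F_less[OF assms]] .
qed

lemma F_sh_h: "x \<in> top.X \<Longrightarrow> F (sh (int h) x) = (shift (fst (F x)), snd (F x))"
  using F_sh[of x h] snd_F_less[of x] h by (simp add: shift_eq_sh)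

lemma E_shift: "x \<in> base.X \<Longrightarrow> i < h \<Longrightarrow> E (shift x, i) = sh (int h) (E (x, i))"
  by (rule F_eqI) (auto simp: F_sh_h shift_eq_sh)

lemma E_level: assumes "x \<in> base.X" "j < h" shows "E (x, j) = sh (int j) (E (x, 0))"
  by (rule F_eqI) (use assms h in \<open>auto simp: F_sh\<close>)

section \<open>Lifting automorphisms of the base to the tower\<close>

definition lift :: "((int \<Rightarrow> 'b) \<Rightarrow> (int \<Rightarrow> 'b)) \<Rightarrow> ((int \<Rightarrow> 'a) \<Rightarrow> (int \<Rightarrow> 'a))" where
  "lift \<Phi> = pull_back (X_top r \<theta>) F (level_map \<Phi>)"

lemma lift_apply: "x \<in> top.X \<Longrightarrow> lift \<Phi> x = E (\<Phi> (fst (F x)), snd (F x))"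
  by (simp add: lift_def pull_back_def E_def level_map_def case_prod_beta)

lemma F_lift:
  "\<Phi> \<in> carrier base.G \<Longrightarrow> x \<in> top.X \<Longrightarrow> F (lift \<Phi> x) = (\<Phi> (fst (F x)), snd (F x))"
  by (simp add: lift_apply base.Aut_X fst_F_in snd_F_less)

lemma lift_Aut: assumes \<Phi>: "\<Phi> \<in> carrier base.G" shows "lift \<Phi> \<in> carrier top.G"
proof -
  have comm: "\<And>x. x \<in> base.X \<Longrightarrow> \<Phi> (shift x) = shift (\<Phi> x)"
    using base.Aut_sh[OF \<Phi>] by (simp add: shift_eq_sh)
  obtain g where g: "homeomorphic_maps (X_top r \<theta>') (X_top r \<theta>') \<Phi> g"
    using \<Phi> by (auto simp: Aut_carrier_iff homeomorphic_map_maps)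
  have "homeomorphic_maps (tower_top r \<theta>' h) (tower_top r \<theta>' h)
      (\<lambda>(x, y). (\<Phi> x, id y)) (\<lambda>(x, y). (g x, id y))"
    unfolding tower_top_def homeomorphic_maps_prod using g homeomorphic_maps_id by blast
  then have "homeomorphic_map (tower_top r \<theta>' h) (tower_top r \<theta>' h) (level_map \<Phi>)"
    unfolding level_map_def id_def by (rule homeomorphic_maps_imp_map)
  moreover have "homeomorphic_map (tower_top r \<theta>' h) (X_top r \<theta>) E"
    using FE_homeomorphic_maps homeomorphic_maps_map by blast
  ultimately have "homeomorphic_map (X_top r \<theta>) (X_top r \<theta>) (E \<circ> (level_map \<Phi> \<circ> F))"
    by (rule homeomorphic_map_compose[OF homeomorphic_map_compose[OF F_homeomorphic]])
  then have "homeomorphic_map (X_top r \<theta>) (X_top r \<theta>) (lift \<Phi>)"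
    by (rule homeomorphic_map_eq) (simp add: lift_apply level_map_def case_prod_beta)
  moreover have "lift \<Phi> (shift x) = shift (lift \<Phi> x)" if x: "x \<in> top.X" for x
  proof -
    have sx: "shift x \<in> top.X" using x by (simp add: shift_eq_sh)
    have lx: "lift \<Phi> x \<in> top.X" using x \<Phi> by (simp add: lift_apply base.Aut_X fst_F_in snd_F_less)
    have "lift \<Phi> (shift x) = E (level_map \<Phi> (tower_map h (F x)))"
      using sx by (simp add: lift_apply level_map_def case_prod_beta F_shift[OF x])
    also have "\<dots> = E (tower_map h (level_map \<Phi> (F x)))"
      using level_tower_commute[where X = base.X and \<Phi> = \<Phi>, OF comm fst_F_in[OF x]] by simp
    also have "level_map \<Phi> (F x) = F (lift \<Phi> x)"
      using F_lift[OF \<Phi> x] by (simp add: level_map_def case_prod_beta)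
    also have "E (tower_map h (F (lift \<Phi> x))) = shift (lift \<Phi> x)"
      using lx by (simp flip: F_shift) (simp add: shift_eq_sh)
    finally show ?thesis .
  qed
  ultimately show ?thesis by (auto simp: Aut_carrier_iff lift_def pull_back_def)
qed

lemma lift_hom: "lift \<in> hom base.G top.G"
proof (rule homI)
  fix \<Phi> \<Psi> assume \<Phi>: "\<Phi> \<in> carrier base.G" and \<Psi>: "\<Psi> \<in> carrier base.G"
  then have \<Phi>\<Psi>: "\<Phi> \<otimes>\<^bsub>base.G\<^esub> \<Psi> \<in> carrier base.G" by simp
  show "lift (\<Phi> \<otimes>\<^bsub>base.G\<^esub> \<Psi>) = lift \<Phi> \<otimes>\<^bsub>top.G\<^esub> lift \<Psi>"
  proof (rule Aut_eqI[of _ "X_top r \<theta>" shift])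
    fix x assume "x \<in> topspace (X_top r \<theta>)"
    then have x: "x \<in> top.X" by simp
    have y: "lift \<Psi> x \<in> top.X" using top.Aut_X[OF lift_Aut[OF \<Psi>] x] .
    have "(lift \<Phi> \<otimes>\<^bsub>top.G\<^esub> lift \<Psi>) x = lift \<Phi> (lift \<Psi> x)"
      using x lift_Aut \<Phi> \<Psi> by (simp add: Aut_mult_apply)
    also have "\<dots> = E (\<Phi> (\<Psi> (fst (F x))), snd (F x))"
      using y by (simp add: lift_apply[of "lift \<Psi> x"] F_lift[OF \<Psi> x])
    also have "\<dots> = lift (\<Phi> \<otimes>\<^bsub>base.G\<^esub> \<Psi>) x"
      using x \<Phi> \<Psi> fst_F_in[OF x] by (simp add: lift_apply Aut_mult_apply)
    finally show "lift (\<Phi> \<otimes>\<^bsub>base.G\<^esub> \<Psi>) x = (lift \<Phi> \<otimes>\<^bsub>top.G\<^esub> lift \<Psi>) x" by (rule sym)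
  qed (use lift_Aut \<Phi> \<Psi> \<Phi>\<Psi> in auto)
qed (rule lift_Aut)

lemma lift_int_pow:
  "\<Phi> \<in> carrier base.G \<Longrightarrow> lift (\<Phi> [^]\<^bsub>base.G\<^esub> (n::int)) = lift \<Phi> [^]\<^bsub>top.G\<^esub> n"
  by (rule hom_int_pow[OF lift_hom _ base.Aut.group_axioms top.Aut.group_axioms])

text \<open>T^h returns every floor to itself and acts on it as the base shift. With \<Phi>^k equal
  to that shift, this becomes the relation between the two generators.\<close>

lemma lift_\<sigma>: "lift base.\<sigma> = top.\<sigma> [^]\<^bsub>top.G\<^esub> h"
proof (rule Aut_eqI[of _ "X_top r \<theta>" shift])
  show "lift base.\<sigma> \<in> carrier top.G" by (rule lift_Aut[OF base.\<sigma>_Aut])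
  show "top.\<sigma> [^]\<^bsub>top.G\<^esub> h \<in> carrier top.G" using top.\<sigma>_Aut by simp
  fix x assume "x \<in> topspace (X_top r \<theta>)"
  then have x: "x \<in> top.X" by simp
  have "lift base.\<sigma> x = E (F (sh (int h) x))" using x fst_F_in[OF x] by (simp add: lift_apply F_sh_h)
  also have "\<dots> = sh (int h) x" using x by simp
  also have "\<dots> = (top.\<sigma> [^]\<^bsub>top.G\<^esub> int h) x" unfolding top.\<sigma>_int_pow using x by simp
  finally show "lift base.\<sigma> x = (top.\<sigma> [^]\<^bsub>top.G\<^esub> h) x" by (simp add: int_pow_int)
qed

lemma pull_back_tower_map: "pull_back (X_top r \<theta>) F (tower_map h) = top.\<sigma>"
proof
  fix x
  show "pull_back (X_top r \<theta>) F (tower_map h) x = top.\<sigma> x"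
  proof (cases "x \<in> top.X")
    case True
    then have "shift x \<in> top.X" by (simp add: shift_eq_sh)
    then show ?thesis using True by (simp add: pull_back_def flip: F_shift E_def)
  qed (simp add: pull_back_def)
qed

lemma lift_one_imp: assumes \<Phi>: "\<Phi> \<in> carrier base.G" and one: "lift \<Phi> = \<one>\<^bsub>top.G\<^esub>" shows "\<Phi> = \<one>\<^bsub>base.G\<^esub>"
proof (rule Aut_eqI[of _ "X_top r \<theta>'" shift])
  fix x assume "x \<in> topspace (X_top r \<theta>')"
  then have x: "x \<in> base.X" by simp
  have "F (lift \<Phi> (E (x, 0))) = (\<Phi> x, 0)" using F_lift[OF \<Phi>, of "E (x, 0)"] x h by simp
  moreover have "lift \<Phi> (E (x, 0)) = E (x, 0)" unfolding one using x h by (simp add: Aut_one)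
  ultimately have "\<Phi> x = x" using x h by simp
  then show "\<Phi> x = \<one>\<^bsub>base.G\<^esub> x" using x by (simp add: Aut_one)
qed (use \<Phi> in auto)

text \<open>T^i moves the bottom floor to floor i modulo h, whereas a lift keeps every
  floor.\<close>

lemma level_of_\<sigma>_pow_eq_lift:
  assumes \<Phi>: "\<Phi> \<in> carrier base.G" and eq: "top.\<sigma> [^]\<^bsub>top.G\<^esub> (i::int) = lift \<Phi>"
  shows "int h dvd i"
proof -
  obtain x where x: "x \<in> base.X" using base.X_nonempty by blast
  define y where "y = E (x, 0)"
  have y: "y \<in> top.X" "snd (F y) = 0" using x h by (auto simp: y_def)
  have "sh i y = lift \<Phi> y" using y unfolding eq[symmetric] top.\<sigma>_int_pow by simp
  then have 0: "snd (F (sh i y)) = 0" using F_lift[OF \<Phi> y(1)] y(2) by simp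
  show ?thesis
  proof (cases "i \<ge> 0")
    case True
    then have "nat i mod h = 0" using 0 F_sh[OF y(1), of "nat i"] y(2) by simp
    then have "int h dvd int (nat i)" unfolding of_nat_dvd_iff by (simp only: mod_eq_0_iff_dvd)
    then show ?thesis using True by (simp only: nat_0_le)
  next
    case False
    then have "sh (int (nat (- i))) (sh i y) = y" by simp
    then have "nat (- i) mod h = 0" using 0 F_sh[of "sh i y" "nat (- i)"] y by simp
    then have "int h dvd int (nat (- i))" unfolding of_nat_dvd_iff by (simp only: mod_eq_0_iff_dvd)
    moreover have "int (nat (- i)) = - i" using False by simp
    ultimately show ?thesis by (simp only: dvd_minus_iff)
  qed
qed

text \<open>Only the bottom floor is inspected: floor j is its image under T^j, with which
  automorphisms commute.\<close>

definition level :: "((int \<Rightarrow> 'a) \<Rightarrow> (int \<Rightarrow> 'a)) \<Rightarrow> (int \<Rightarrow> 'b) \<Rightarrow> nat" where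
  "level \<Psi> x = snd (F (\<Psi> (E (x, 0))))"

definition floor_map :: "((int \<Rightarrow> 'a) \<Rightarrow> (int \<Rightarrow> 'a)) \<Rightarrow> (int \<Rightarrow> 'b) \<Rightarrow> (int \<Rightarrow> 'b)" where
  "floor_map \<Psi> x = fst (F (\<Psi> (E (x, 0))))"

lemma bottom_continuous:
  assumes \<Psi>: "\<Psi> \<in> carrier top.G"
  shows "continuous_map (X_top r \<theta>') (tower_top r \<theta>' h) (\<lambda>x. F (\<Psi> (E (x, 0))))"
proof -
  have "continuous_map (X_top r \<theta>) (X_top r \<theta>) \<Psi>"
    using \<Psi> homeomorphic_imp_continuous_map by (auto simp: Aut_carrier_iff)
  moreover have "continuous_map (X_top r \<theta>') (tower_top r \<theta>' h) (\<lambda>x. (x, 0))"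
    unfolding tower_top_def using h by (auto intro!: continuous_map_pairedI)
  ultimately have "continuous_map (X_top r \<theta>') (tower_top r \<theta>' h) (F \<circ> (\<Psi> \<circ> (E \<circ> (\<lambda>x. (x, 0)))))"
    using F_continuous E_continuous by (intro continuous_map_compose)
  then show ?thesis by (simp add: o_def)
qed

lemma bottom_shift:
  assumes \<Psi>: "\<Psi> \<in> carrier top.G" and x: "x \<in> base.X"
  shows "F (\<Psi> (E (shift x, 0))) = (shift (floor_map \<Psi> x), level \<Psi> x)"
proof -
  have y: "E (x, 0) \<in> top.X" using x h by simp
  then show ?thesis
    using F_sh_h[OF top.Aut_X[OF \<Psi> y]] E_shift[OF x h] top.Aut_sh[OF \<Psi> y]
    by (simp add: floor_map_def level_def)
qed

text \<open>T^h commutes with \<Psi>, keeps floors and acts as the base shift, so the level is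
  shift-invariant; it is also continuous into a finite discrete set.\<close>

lemma level_constant:
  assumes \<Psi>: "\<Psi> \<in> carrier top.G" and "x \<in> base.X" "y \<in> base.X"
  shows "level \<Psi> x = level \<Psi> y"
proof (rule base.invariant_constant[OF _ _ assms(2,3)])
  have "continuous_map (X_top r \<theta>') (discrete_topology {0..<h}) (snd \<circ> (\<lambda>x. F (\<Psi> (E (x, 0)))))"
    using bottom_continuous[OF \<Psi>] unfolding tower_top_def
    by (rule continuous_map_compose) (rule continuous_map_snd)
  then have "continuous_map (X_top r \<theta>') (subtopology (discrete_topology UNIV) {0..<h}) (level \<Psi>)"
    by (simp add: o_def level_def[abs_def])
  then show "base.locally_constant (level \<Psi>)"
    by (intro base.continuous_imp_locally_constant) (simp only: continuous_map_in_subtopology)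
  show "level \<Psi> (shift x) = level \<Psi> x" if "x \<in> base.X" for x
    using bottom_shift[OF \<Psi> that] by (simp add: level_def)
qed

text \<open>The candidate is \<open>floor_map \<Psi>\<close>. To be invertible it needs the inverse
  of \<Psi> to keep the bottom floor too, and then the floor map of that inverse is its
  inverse.\<close>

lemma level_zero_imp_lift:
  assumes \<Psi>: "\<Psi> \<in> carrier top.G" and level: "\<And>x. x \<in> base.X \<Longrightarrow> level \<Psi> x = 0"
  shows "\<exists>\<Phi>\<in>carrier base.G. \<Psi> = lift \<Phi>"
proof -
  define \<Psi>' where "\<Psi>' = inv\<^bsub>top.G\<^esub> \<Psi>"
  have \<Psi>': "\<Psi>' \<in> carrier top.G" using \<Psi> by (simp add: \<Psi>'_def)
  have inv: "\<Psi>' (\<Psi> x) = x" "\<Psi> (\<Psi>' x) = x" if "x \<in> top.X" for x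
  proof -
    have "(\<Psi>' \<otimes>\<^bsub>top.G\<^esub> \<Psi>) x = \<one>\<^bsub>top.G\<^esub> x" "(\<Psi> \<otimes>\<^bsub>top.G\<^esub> \<Psi>') x = \<one>\<^bsub>top.G\<^esub> x"
      using \<Psi> by (simp_all add: \<Psi>'_def)
    then show "\<Psi>' (\<Psi> x) = x" "\<Psi> (\<Psi>' x) = x"
      using \<Psi> \<Psi>' that by (simp_all add: Aut_mult_apply) (simp_all add: Aut_one)
  qed
  have bottom: "\<Psi> (E (x, 0)) = E (floor_map \<Psi> x, 0)" "floor_map \<Psi> x \<in> base.X" if x: "x \<in> base.X" for x
  proof -
    have y: "\<Psi> (E (x, 0)) \<in> top.X" using top.Aut_X[OF \<Psi>] x h by simp
    have "F (\<Psi> (E (x, 0))) = (floor_map \<Psi> x, 0)"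
      using level[OF x] by (simp add: floor_map_def level_def prod_eq_iff)
    then show "\<Psi> (E (x, 0)) = E (floor_map \<Psi> x, 0)" using E_F[OF y] by simp
    show "floor_map \<Psi> x \<in> base.X" using fst_F_in[OF y] by (simp add: floor_map_def)
  qed
  \<comment> \<open>The level of the inverse is constant, so it may be computed at a bottom point
    known to be an image under \<Psi>.\<close>
  have level': "level \<Psi>' x = 0" if x: "x \<in> base.X" for x
  proof -
    have "level \<Psi>' x = level \<Psi>' (floor_map \<Psi> x)"
      using level_constant[OF \<Psi>' x] bottom(2)[OF x] by blast
    also have "\<dots> = snd (F (\<Psi>' (\<Psi> (E (x, 0)))))" using bottom(1)[OF x] by (simp add: level_def)
    also have "\<dots> = 0" using inv(1) x h by simp
    finally show ?thesis .
  qed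
  have bottom': "\<Psi>' (E (x, 0)) = E (floor_map \<Psi>' x, 0)" "floor_map \<Psi>' x \<in> base.X" if x: "x \<in> base.X" for x
  proof -
    have y: "\<Psi>' (E (x, 0)) \<in> top.X" using top.Aut_X[OF \<Psi>'] x h by simp
    have "F (\<Psi>' (E (x, 0))) = (floor_map \<Psi>' x, 0)"
      using level'[OF x] by (simp add: floor_map_def level_def prod_eq_iff)
    then show "\<Psi>' (E (x, 0)) = E (floor_map \<Psi>' x, 0)" using E_F[OF y] by simp
    show "floor_map \<Psi>' x \<in> base.X" using fst_F_in[OF y] by (simp add: floor_map_def)
  qed
  define \<Phi> where "\<Phi> = restrict (floor_map \<Psi>) base.X"
  have cont: "continuous_map (X_top r \<theta>') (X_top r \<theta>') (floor_map \<Omega>)" if \<Omega>: "\<Omega> \<in> carrier top.G" for \<Omega>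
  proof -
    have "continuous_map (X_top r \<theta>') (X_top r \<theta>') (fst \<circ> (\<lambda>x. F (\<Omega> (E (x, 0)))))"
      using bottom_continuous[OF \<Omega>] unfolding tower_top_def
      by (rule continuous_map_compose) (rule continuous_map_fst)
    then show ?thesis by (simp add: o_def floor_map_def[abs_def])
  qed
  have "floor_map \<Psi>' (floor_map \<Psi> x) = x" if x: "x \<in> base.X" for x
    using inv(1)[of "E (x, 0)"] bottom(1)[OF x] x h unfolding floor_map_def[of \<Psi>'] by simp
  moreover have "floor_map \<Psi> (floor_map \<Psi>' x) = x" if x: "x \<in> base.X" for x
    using inv(2)[of "E (x, 0)"] bottom'(1)[OF x] x h unfolding floor_map_def[of \<Psi>] by simp
  ultimately have "homeomorphic_maps (X_top r \<theta>') (X_top r \<theta>') (floor_map \<Psi>) (floor_map \<Psi>')"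
    using cont \<Psi> \<Psi>' by (simp add: homeomorphic_maps_def)
  then have "homeomorphic_map (X_top r \<theta>') (X_top r \<theta>') (floor_map \<Psi>)" by (rule homeomorphic_maps_imp_map)
  then have "homeomorphic_map (X_top r \<theta>') (X_top r \<theta>') \<Phi>"
    unfolding \<Phi>_def by (rule homeomorphic_map_eq) simp
  moreover have "\<Phi> (shift x) = shift (\<Phi> x)" if x: "x \<in> base.X" for x
  proof -
    have "shift x \<in> base.X" using x by (simp add: shift_eq_sh)
    then show ?thesis using bottom_shift[OF \<Psi> x] x by (simp add: \<Phi>_def floor_map_def)
  qed
  ultimately have \<Phi>: "\<Phi> \<in> carrier base.G" by (auto simp: Aut_carrier_iff \<Phi>_def)
  have "\<Psi> = lift \<Phi>"
  proof (rule Aut_eqI[OF \<Psi> lift_Aut[OF \<Phi>]])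
    fix x assume "x \<in> topspace (X_top r \<theta>)"
    then have x: "x \<in> top.X" by simp
    \<comment> \<open>A point of floor j is j shifts above the bottom, which reduces the claim to
      the bottom floor.\<close>
    define x' j where "x' = fst (F x)" and "j = snd (F x)"
    have x': "x' \<in> base.X" "j < h" using fst_F_in[OF x] snd_F_less[OF x] by (auto simp: x'_def j_def)
    have "x = E (x', j)" using E_F[OF x] by (simp add: x'_def j_def)
    also have "\<dots> = sh (int j) (E (x', 0))" by (rule E_level[OF x'])
    finally have "\<Psi> x = sh (int j) (E (floor_map \<Psi> x', 0))"
      using top.Aut_sh[OF \<Psi>, of "E (x', 0)"] bottom(1)[OF x'(1)] x'(1) h by simp
    also have "\<dots> = E (\<Phi> x', j)" using E_level[OF bottom(2)[OF x'(1)] x'(2)] x'(1) by (simp add: \<Phi>_def)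
    also have "\<dots> = lift \<Phi> x" using x by (simp add: lift_apply x'_def j_def)
    finally show "\<Psi> x = lift \<Phi> x" .
  qed
  then show ?thesis using \<Phi> by blast
qed

lemma Aut_decomposition:
  assumes \<Psi>: "\<Psi> \<in> carrier top.G"
  shows "\<exists>(i::int). \<exists>\<Phi>\<in>carrier base.G. \<Psi> = top.\<sigma> [^]\<^bsub>top.G\<^esub> i \<otimes>\<^bsub>top.G\<^esub> lift \<Phi>"
proof -
  obtain x0 where x0: "x0 \<in> base.X" using base.X_nonempty by blast
  define i where "i = level \<Psi> x0"
  define \<Psi>0 where "\<Psi>0 = top.\<sigma> [^]\<^bsub>top.G\<^esub> (- int i) \<otimes>\<^bsub>top.G\<^esub> \<Psi>"
  have \<Psi>0: "\<Psi>0 \<in> carrier top.G" using \<Psi> top.\<sigma>_Aut by (simp add: \<Psi>0_def)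
  have "level \<Psi>0 x = 0" if x: "x \<in> base.X" for x
  proof -
    define w where "w = \<Psi> (E (x, 0))"
    have w: "w \<in> top.X" using top.Aut_X[OF \<Psi>] x h by (simp add: w_def)
    have "snd (F w) = i" using level_constant[OF \<Psi> x x0] by (simp add: i_def level_def w_def)
    \<comment> \<open>\<open>F_sh\<close> treats forward shifts only, so the floor j of the point i
      steps before w is recovered from j + i \<equiv> i modulo h and j < h.\<close>
    moreover have "snd (F (sh (int i) (sh (- int i) w))) = (snd (F (sh (- int i) w)) + i) mod h"
      using w by (subst F_sh) simp_all
    ultimately have i: "(snd (F (sh (- int i) w)) + i) mod h = i"
      unfolding sh_sh add.right_inverse sh_0 by (simp only:)
    define j where "j = snd (F (sh (- int i) w))"
    have "j < h" using snd_F_less[of "sh (- int i) w"] w by (simp add: j_def)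
    have "i < h" by (subst i[symmetric]) (rule mod_less_divisor[OF h])
    have "j = 0"
    proof (cases "j + i < h")
      case False
      then have "(j + i) mod h = j + i - h"
        using \<open>j < h\<close> \<open>i < h\<close> by (simp add: le_mod_geq)
      then show ?thesis using i False \<open>j < h\<close> by (simp add: j_def)
    qed (use i in \<open>simp add: j_def\<close>)
    moreover have "\<Psi>0 (E (x, 0)) = sh (- int i) w"
      unfolding \<Psi>0_def top.\<sigma>_int_pow
      using x h w \<Psi> top.restrict_sh_Aut by (simp add: Aut_mult_apply w_def)
    ultimately show ?thesis by (simp add: level_def j_def)
  qed
  then obtain \<Phi> where \<Phi>: "\<Phi> \<in> carrier base.G" "\<Psi>0 = lift \<Phi>" using level_zero_imp_lift[OF \<Psi>0] by blast
  have "top.\<sigma> [^]\<^bsub>top.G\<^esub> int i \<otimes>\<^bsub>top.G\<^esub> \<Psi>0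
      = (top.\<sigma> [^]\<^bsub>top.G\<^esub> int i \<otimes>\<^bsub>top.G\<^esub> top.\<sigma> [^]\<^bsub>top.G\<^esub> (- int i)) \<otimes>\<^bsub>top.G\<^esub> \<Psi>"
    unfolding \<Psi>0_def using \<Psi> top.\<sigma>_Aut by (intro top.Aut.m_assoc[symmetric]) auto
  also have "\<dots> = \<Psi>"
    unfolding top.Aut.int_pow_mult[OF top.\<sigma>_Aut, symmetric] using \<Psi> by simp
  finally have "\<Psi> = top.\<sigma> [^]\<^bsub>top.G\<^esub> int i \<otimes>\<^bsub>top.G\<^esub> \<Psi>0" by (rule sym)
  then show ?thesis using \<Phi> by blast
qed

lemma \<sigma>_pow_central:
  assumes \<Psi>: "\<Psi> \<in> carrier top.G"
  shows "\<Psi> \<otimes>\<^bsub>top.G\<^esub> top.\<sigma> [^]\<^bsub>top.G\<^esub> (i::int) = top.\<sigma> [^]\<^bsub>top.G\<^esub> i \<otimes>\<^bsub>top.G\<^esub> \<Psi>"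
proof (rule Aut_eqI[of _ "X_top r \<theta>" shift])
  fix x assume "x \<in> topspace (X_top r \<theta>)"
  then show "(\<Psi> \<otimes>\<^bsub>top.G\<^esub> top.\<sigma> [^]\<^bsub>top.G\<^esub> i) x = (top.\<sigma> [^]\<^bsub>top.G\<^esub> i \<otimes>\<^bsub>top.G\<^esub> \<Psi>) x"
    unfolding top.\<sigma>_int_pow using \<Psi> top.restrict_sh_Aut[of i]
    by (simp add: Aut_mult_apply top.Aut_X top.Aut_sh)
qed (use \<Psi> top.\<sigma>_Aut in auto)

lemma Aut_tower:
  assumes inj: "inj_on base.\<kappa> (carrier base.G)" and rg: "reciprocal_generator r \<theta>' \<pi> \<Phi> k"
  shows "comm_group top.G" "lift \<Phi> \<in> carrier top.G" "carrier top.G = generate top.G {top.\<sigma>, lift \<Phi>}"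
    "cyclic_group top.G \<longleftrightarrow> gcd k h = 1"
proof -
  have \<Phi>: "\<Phi> \<in> carrier base.G" using rg unfolding reciprocal_generator_def by blast
  note \<Phi>_pow = base.reciprocal_generator_pow[OF inj rg]
  define p where "p = lift \<Phi>"
  have p: "p \<in> carrier top.G" using lift_Aut[OF \<Phi>] by (simp add: p_def)
  define s where "s = top.\<sigma>"
  have s: "s \<in> carrier top.G" using top.\<sigma>_Aut by (simp add: s_def)
  have gen: "\<exists>(i::int) n::int. \<Psi> = s [^]\<^bsub>top.G\<^esub> i \<otimes>\<^bsub>top.G\<^esub> p [^]\<^bsub>top.G\<^esub> n" if "\<Psi> \<in> carrier top.G" for \<Psi>
    using Aut_decomposition[OF that] \<Phi>_pow(2) lift_int_pow[OF \<Phi>] unfolding p_def s_def by (metis imageE)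
  \<comment> \<open>Powers of the shift are central, so products collect into the normal form s^i
    p^n with exponents adding up; commutativity is then immediate.\<close>
  have mult: "(s [^]\<^bsub>top.G\<^esub> i \<otimes>\<^bsub>top.G\<^esub> p [^]\<^bsub>top.G\<^esub> n) \<otimes>\<^bsub>top.G\<^esub> (s [^]\<^bsub>top.G\<^esub> j \<otimes>\<^bsub>top.G\<^esub> p [^]\<^bsub>top.G\<^esub> m)
      = s [^]\<^bsub>top.G\<^esub> (i + j) \<otimes>\<^bsub>top.G\<^esub> p [^]\<^bsub>top.G\<^esub> (n + m)" for i j n m :: int
  proof -
    have "(s [^]\<^bsub>top.G\<^esub> i \<otimes>\<^bsub>top.G\<^esub> p [^]\<^bsub>top.G\<^esub> n) \<otimes>\<^bsub>top.G\<^esub> (s [^]\<^bsub>top.G\<^esub> j \<otimes>\<^bsub>top.G\<^esub> p [^]\<^bsub>top.G\<^esub> m)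
        = s [^]\<^bsub>top.G\<^esub> i \<otimes>\<^bsub>top.G\<^esub> (p [^]\<^bsub>top.G\<^esub> n \<otimes>\<^bsub>top.G\<^esub> s [^]\<^bsub>top.G\<^esub> j) \<otimes>\<^bsub>top.G\<^esub> p [^]\<^bsub>top.G\<^esub> m"
      using p s by (simp add: top.Aut.m_assoc)
    also have "p [^]\<^bsub>top.G\<^esub> n \<otimes>\<^bsub>top.G\<^esub> s [^]\<^bsub>top.G\<^esub> j = s [^]\<^bsub>top.G\<^esub> j \<otimes>\<^bsub>top.G\<^esub> p [^]\<^bsub>top.G\<^esub> n"
      using p unfolding s_def by (intro \<sigma>_pow_central) auto
    finally show ?thesis using p s by (simp add: top.Aut.m_assoc top.Aut.int_pow_mult)
  qed
  show comm: "comm_group top.G"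
  proof (rule top.Aut.group_comm_groupI)
    fix \<Psi> \<Omega> assume "\<Psi> \<in> carrier top.G" "\<Omega> \<in> carrier top.G"
    then obtain i n j m :: int where
      "\<Psi> = s [^]\<^bsub>top.G\<^esub> i \<otimes>\<^bsub>top.G\<^esub> p [^]\<^bsub>top.G\<^esub> n" "\<Omega> = s [^]\<^bsub>top.G\<^esub> j \<otimes>\<^bsub>top.G\<^esub> p [^]\<^bsub>top.G\<^esub> m"
      using gen by meson
    then show "\<Psi> \<otimes>\<^bsub>top.G\<^esub> \<Omega> = \<Omega> \<otimes>\<^bsub>top.G\<^esub> \<Psi>" using mult by (simp add: add.commute)
  qed
  show "lift \<Phi> \<in> carrier top.G" using p by (simp add: p_def)
  show "carrier top.G = generate top.G {top.\<sigma>, lift \<Phi>}"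
    unfolding s_def[symmetric]
  proof
    have sg: "subgroup (generate top.G {s, p}) top.G"
      using p s by (intro top.Aut.generate_is_subgroup) auto
    have "s \<in> generate top.G {s, p}" "p \<in> generate top.G {s, p}"
      by (auto intro: generate.incl)
    then have "s [^]\<^bsub>top.G\<^esub> i \<otimes>\<^bsub>top.G\<^esub> p [^]\<^bsub>top.G\<^esub> n \<in> generate top.G {s, p}" for i n :: int
      using top.Aut.subgroup_int_pow_closed[OF sg] subgroup.m_closed[OF sg] by blast
    then show "carrier top.G \<subseteq> generate top.G {s, lift \<Phi>}" using gen unfolding p_def by blast
    show "generate top.G {s, lift \<Phi>} \<subseteq> carrier top.G"
      using p s unfolding p_def by (intro top.Aut.generate_incl) auto
  qed
  interpret cg: comm_group top.G by (rule comm)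
  show "cyclic_group top.G \<longleftrightarrow> gcd k h = 1"
  proof (rule cg.cyclic_iff_coprime_relation[OF s p h gen])
    have "lift (\<Phi> [^]\<^bsub>base.G\<^esub> int k) = p [^]\<^bsub>top.G\<^esub> int k" unfolding p_def by (rule lift_int_pow[OF \<Phi>])
    then show "s [^]\<^bsub>top.G\<^esub> h = p [^]\<^bsub>top.G\<^esub> k" using \<Phi>_pow(1) lift_\<sigma> unfolding s_def by (simp only: int_pow_int)
    show "int h dvd i" if "s [^]\<^bsub>top.G\<^esub> i = p [^]\<^bsub>top.G\<^esub> n" for i n :: int
      using level_of_\<sigma>_pow_eq_lift[of "\<Phi> [^]\<^bsub>base.G\<^esub> n" i] \<Phi> that by (simp add: lift_int_pow p_def s_def)
    show "n = 0" if "p [^]\<^bsub>top.G\<^esub> n = \<one>\<^bsub>top.G\<^esub>" for n :: int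
    proof -
      have "\<Phi> [^]\<^bsub>base.G\<^esub> n = \<one>\<^bsub>base.G\<^esub>"
        using \<Phi> that by (intro lift_one_imp) (auto simp: lift_int_pow p_def)
      \<comment> \<open>Exchanging the exponents n and k turns \<Phi>^n = 1 into triviality of the
        n-th power of the base shift, which has infinite order.\<close>
      then have "(\<Phi> [^]\<^bsub>base.G\<^esub> n) [^]\<^bsub>base.G\<^esub> int k = \<one>\<^bsub>base.G\<^esub>" by simp
      then have "(\<Phi> [^]\<^bsub>base.G\<^esub> int k) [^]\<^bsub>base.G\<^esub> n = \<one>\<^bsub>base.G\<^esub>"
        using \<Phi> by (simp add: base.Aut.int_pow_pow mult.commute)
      then show ?thesis using base.\<sigma>_infinite_order \<Phi>_pow(1) by (simp only: int_pow_int)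
    qed
  qed
qed

end

theorem corollary3p7:
  fixes r :: nat
    and \<theta> :: "'a::finite \<Rightarrow> 'a list"
    and \<theta>' :: "'b::finite \<Rightarrow> 'b list"
  assumes "substitution r \<theta>" and "primitive \<theta>" and "infinite (X_shift r \<theta>)"
  shows
    "(\<forall>\<pi>. height r \<theta> = 1 \<and> radic_mef r \<theta> \<pi> \<longrightarrow>
        (inj_on (kappa r \<theta> \<pi>) (carrier (Aut (X_top r \<theta>) shift)) \<longrightarrow>
           cyclic_group (Aut (X_top r \<theta>) shift)) \<and>
        (has_coincidence r \<theta> \<longrightarrow>
           inj_on (kappa r \<theta> \<pi>) (carrier (Aut (X_top r \<theta>) shift))))
     \<and>
     (\<forall>h \<pi> F. height r \<theta> = h \<and> h > 1 \<and> pure_base r \<theta> \<theta>' \<and> tower_conjugacy r \<theta> \<theta>' F \<and>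
        radic_mef r \<theta>' \<pi> \<and> inj_on (kappa r \<theta>' \<pi>) (carrier (Aut (X_top r \<theta>') shift)) \<longrightarrow>
        (\<exists>\<Phi> k. reciprocal_generator r \<theta>' \<pi> \<Phi> k) \<and>
        (\<forall>\<Phi> k. reciprocal_generator r \<theta>' \<pi> \<Phi> k \<longrightarrow>
           (let G = Aut (X_top r \<theta>) shift;
                T' = pull_back (X_top r \<theta>) F (tower_map h);
                \<Phi>\<^sub>0 = pull_back (X_top r \<theta>) F (level_map \<Phi>)
            in comm_group G \<and> T' \<in> carrier G \<and> \<Phi>\<^sub>0 \<in> carrier G \<and>
               carrier G = generate G {T', \<Phi>\<^sub>0} \<and>
               (cyclic_group G \<longleftrightarrow> gcd k h = 1))))"
proof (intro conjI allI impI)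
  interpret top: aperiodic_substitution r \<theta> by (rule aperiodic_substitution.intro[OF assms])
  {
    fix \<pi> assume "height r \<theta> = 1 \<and> radic_mef r \<theta> \<pi>"
    then interpret odometer_factor r \<theta> \<pi>
      by unfold_locales (simp add: radic_mef_def max_equicontinuous_factor_def)
    show "cyclic_group (Aut (X_top r \<theta>) shift)" if "inj_on (kappa r \<theta> \<pi>) (carrier (Aut (X_top r \<theta>) shift))"
      by (rule cyclic_Aut[OF that])
    show "inj_on (kappa r \<theta> \<pi>) (carrier (Aut (X_top r \<theta>) shift))" if "has_coincidence r \<theta>"
      by (rule inj_on_kappa_if_coincidence[OF that])
  }
  fix h \<pi> F
  assume *: "height r \<theta> = h \<and> h > 1 \<and> pure_base r \<theta> \<theta>' \<and> tower_conjugacy r \<theta> \<theta>' F \<and>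
    radic_mef r \<theta>' \<pi> \<and> inj_on (kappa r \<theta>' \<pi>) (carrier (Aut (X_top r \<theta>') shift))"
  have conj: "conjugacy (X_top r \<theta>) shift (tower_top r \<theta>' h) (tower_map h) F"
    using * by (auto simp: tower_conjugacy_def)
  have "bij_betw F (X_shift r \<theta>) (X_shift r \<theta>' \<times> {0..<h})"
    using conj by (auto simp: conjugacy_def homeomorphic_eq_everything_map bij_betw_def tower_top_def X_top_def)
  \<comment> \<open>X is in bijection with h copies of the base space, so a finite base would make X
    finite; hence the results for \<open>aperiodic_substitution\<close> apply to
    \<open>\<theta>'\<close>.\<close>
  then have "infinite (X_shift r \<theta>')" using assms(3) by (metis bij_betw_finite finite_SigmaI finite_atLeastLessThan)
  then interpret tower r \<theta>' \<pi> \<theta> h F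
    using * conj by unfold_locales
      (auto simp: pure_base_def radic_mef_def max_equicontinuous_factor_def)
  have inj: "inj_on base.\<kappa> (carrier base.G)" using * by blast
  show "\<exists>\<Phi> k. reciprocal_generator r \<theta>' \<pi> \<Phi> k" by (rule base.reciprocal_generator_exists[OF inj])
  fix \<Phi> k assume rg: "reciprocal_generator r \<theta>' \<pi> \<Phi> k"
  show "let G = Aut (X_top r \<theta>) shift;
                T' = pull_back (X_top r \<theta>) F (tower_map h);
                \<Phi>\<^sub>0 = pull_back (X_top r \<theta>) F (level_map \<Phi>)
            in comm_group G \<and> T' \<in> carrier G \<and> \<Phi>\<^sub>0 \<in> carrier G \<and>
               carrier G = generate G {T', \<Phi>\<^sub>0} \<and>
               (cyclic_group G \<longleftrightarrow> gcd k h = 1)"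
    unfolding Let_def pull_back_tower_map lift_def[symmetric]
    by (intro conjI Aut_tower[OF inj rg] top.\<sigma>_Aut)
qed

end
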